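(* Let $a_1,a_2,b_1,b_2,c_1,c_2,\alpha,\beta,\lambda\in\mathbb{C}$ with $\lambda\ne0$, and put $\varepsilon_0^{(1)}=a_1b_2-a_2b_1$, $\varepsilon_0^{(2)}=b_1c_2-b_2c_1$, $\varepsilon_0^{(3)}=c_1a_2-c_2a_1$, assumed not all zero. For $x\in\mathbb{R}^4$ let $$L=\tfrac{1}{\sqrt2}\big[(\lambda\alpha+\beta)x^1+(\lambda\beta-\alpha)x^2+(\lambda\alpha-\beta)x^3+(\lambda\beta+\alpha)x^4\big],$$ $A=a_1e^L+a_2e^{-L}$, $B=b_1e^L+b_2e^{-L}$, $C=c_1e^L+c_2e^{-L}$, $\Delta=|A|^2+|B|^2+|C|^2$, and $$J=-\psi\Lambda\psi^{-1},\qquad \psi=\begin{pmatrix}A&\overline B&0\\-B&\overline A&C\\0&-\overline C&A\end{pmatrix},\qquad \Lambda=\mathrm{diag}(\lambda,\overline\lambda,\lambda),$$ or equivalently $$J=\frac{-1}{\Delta}\begin{pmatrix}\lambda(|A|^2+|C|^2)+\overline\lambda|B|^2&-(\lambda-\overline\lambda)A\overline B&(\lambda-\overline\lambda)\overline BC\\-(\lambda-\overline\lambda)\overline AB&\lambda(|B|^2+|C|^2)+\overline\lambda|A|^2&(\lambda-\overline\lambda)\overline AC\\(\lambda-\overline\lambda)B\overline C&(\lambda-\overline\lambda)A\overline C&\lambda(|A|^2+|B|^2)+\overline\lambda|C|^2\end{pmatrix}.$$ Put $A_1=A_3=-\frac12[(\partial_1J)J^{-1}+(\partial_3J)J^{-1}]$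 and $A_2=A_4=-\frac12[(\partial_2J)J^{-1}+(\partial_4J)J^{-1}]$. Then $\det J=-|\lambda|^2\lambda$ and $J^\dagger J=JJ^\dagger=|\lambda|^2I$; the $A_\mu$ satisfy the anti-self-dual Yang-Mills equations for the split metric and are anti-Hermitian and traceless (so the gauge group can be $\mathrm{SU}(3)$); and, with $E:=|\varepsilon_0^{(1)}|^2+|\varepsilon_0^{(2)}|^2+|\varepsilon_0^{(3)}|^2$, $$\mathrm{Tr}\,F_{\mu\nu}F^{\mu\nu}=8\big[(\alpha\overline\beta-\overline\alpha\beta)(\lambda-\overline\lambda)\big]^2E\;\frac{2\varepsilon_1\widetilde\varepsilon_1\sinh^2X_1-2|\varepsilon_2|^2\sinh^2X_2-E}{\big[(\varepsilon_1\widetilde\varepsilon_1)^{1/2}\cosh X_1+|\varepsilon_2|\cosh X_2\big]^4},$$ where $\varepsilon_1=|a_1|^2+|b_1|^2+|c_1|^2$, $\widetilde\varepsilon_1=|a_2|^2+|b_2|^2+|c_2|^2$, $\varepsilon_2=a_1\overline a_2+b_1\overline b_2+c_1\overline c_2$ (so that $\varepsilon_1\widetilde\varepsilon_1-|\varepsilon_2|^2=E$), $X_1=\overline L+L+\frac12\log(\varepsilon_1/\widetilde\varepsilon_1)$ and $X_2=\overline L-L+\frac12\log(\varepsilon_2/\overline\varepsilon_2)$. If $\varepsilon_2=0$, the part containing $X_2$ is removed and $$\mathrm{Tr}\,F_{\mu\nu}F^{\mu\nu}=8\big[(\alpha\overline\beta-\overline\alpha\beta)(\lambda-\overline\lambda)\big]^2(2\,\mathrm{sech}^2X-3\,\mathrm{sech}^4X),\quad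 X=L+\overline L+\tfrac12\log\frac{|a_1|^2+|b_1|^2+|c_1|^2}{|a_2|^2+|b_2|^2+|c_2|^2}.$$
   Context: $\partial_\mu=\partial/\partial x^\mu$; $\dagger$ is conjugate transpose. $\mathbb{R}^4$ carries the split metric $ds^2=(dx^1)^2+(dx^2)^2-(dx^3)^2-(dx^4)^2$, used to raise indices; repeated indices are summed. $F_{\mu\nu}=\partial_\mu A_\nu-\partial_\nu A_\mu+[A_\mu,A_\nu]$. With real coordinates $z=(x^1+x^3)/\sqrt2$, $\widetilde z=(x^1-x^3)/\sqrt2$, $w=(x^2+x^4)/\sqrt2$, $\widetilde w=-(x^2-x^4)/\sqrt2$ (so $ds^2=2(dz\,d\widetilde z-dw\,d\widetilde w)$), the anti-self-dual Yang-Mills equations are $F_{zw}=0$, $F_{\widetilde z\widetilde w}=0$, $F_{z\widetilde z}-F_{w\widetilde w}=0$. In these coordinates $L=\lambda\alpha z+\beta\widetilde z+\lambda\beta w+\alpha\widetilde w$, and the gauge fields above are $A_z=-(\partial_zJ)J^{-1}$, $A_w=-(\partial_wJ)J^{-1}$, $A_{\widetilde z}=A_{\widetilde w}=0$.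
   Formalization: X_2 is corrected to L - conj(L) + (1/2)log(eps_2/conj eps_2) with (1/2)log(...) = i arg(eps_2); the printed sign is false for general eps_2. J is the explicit matrix; J = -psi Lambda psi^{-1} is proved where A(x) is nonzero, since psi is singular elsewhere. *)

theory Defs
  imports "HOL-Analysis.Analysis"
begin

definition partial_deriv ::
  "'n::finite \<Rightarrow> (real^'n \<Rightarrow> 'b::real_normed_vector) \<Rightarrow> real^'n \<Rightarrow> 'b"
  where "partial_deriv \<mu> f x = vector_derivative (\<lambda>t. f (x + t *\<^sub>R axis \<mu> 1)) (at 0)"

definition dagger :: "complex^'n^'m \<Rightarrow> complex^'m^'n"
  where "dagger M = (\<chi> i j. cnj (M $ j $ i))"

definition commutator :: "complex^'n^'n \<Rightarrow> complex^'n^'n \<Rightarrow> complex^'n^'n"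
  where "commutator M N = M ** N - N ** M"

text \<open>The type \<^typ>\<open>4\<close> of indices is \<open>{1, 2, 3, 4}\<close>, where the index 4 is the element 0
  of that type. A gauge potential is a family of matrix-valued functions on \<open>real^4\<close>, one for
  each index.\<close>

type_synonym 'n gauge_potential = "4 \<Rightarrow> real^4 \<Rightarrow> complex^'n^'n"

definition field_strength ::
  "'n::finite gauge_potential \<Rightarrow> 4 \<Rightarrow> 4 \<Rightarrow> real^4 \<Rightarrow> complex^'n^'n"
  where "field_strength A \<mu> \<nu> x =
    partial_deriv \<mu> (A \<nu>) x - partial_deriv \<nu> (A \<mu>) x + commutator (A \<mu> x) (A \<nu> x)"

definition split_metric :: "real^4^4"
  where "split_metric = (\<chi> \<mu> \<nu>. if \<mu> \<noteq> \<nu> then 0 else if \<mu> = 1 \<or> \<mu> = 2 then 1 else - 1)"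

definition field_strength_upper ::
  "'n::finite gauge_potential \<Rightarrow> 4 \<Rightarrow> 4 \<Rightarrow> real^4 \<Rightarrow> complex^'n^'n"
  where "field_strength_upper A \<mu> \<nu> x =
    (\<Sum>\<rho>\<in>UNIV. \<Sum>\<sigma>\<in>UNIV.
      (matrix_inv split_metric $ \<mu> $ \<rho> * matrix_inv split_metric $ \<nu> $ \<sigma>)
        *\<^sub>R field_strength A \<rho> \<sigma> x)"

text \<open>The scalar \<open>Tr F\<^sub>\<mu>\<^sub>\<nu> F\<^sup>\<mu>\<^sup>\<nu>\<close>: the sum is over all ordered pairs of indices.\<close>

definition tr_F_F :: "'n::finite gauge_potential \<Rightarrow> real^4 \<Rightarrow> complex"
  where "tr_F_F A x =
    (\<Sum>\<mu>\<in>UNIV. \<Sum>\<nu>\<in>UNIV. trace (field_strength A \<mu> \<nu> x ** field_strength_upper A \<mu> \<nu> x))"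

text \<open>The coordinate vector fields of the null coordinates
  \<open>z = (x\<^sup>1 + x\<^sup>3)/\<surd>2\<close>, \<open>z~ = (x\<^sup>1 - x\<^sup>3)/\<surd>2\<close>, \<open>w = (x\<^sup>2 + x\<^sup>4)/\<surd>2\<close>, \<open>w~ = -(x\<^sup>2 - x\<^sup>4)/\<surd>2\<close>,
  see the lemma \<open>null_coordinates\<close> below.\<close>

definition e_z :: "real^4" where "e_z = (1 / sqrt 2) *\<^sub>R (axis 1 1 + axis 3 1)"
definition e_zt :: "real^4" where "e_zt = (1 / sqrt 2) *\<^sub>R (axis 1 1 - axis 3 1)"
definition e_w :: "real^4" where "e_w = (1 / sqrt 2) *\<^sub>R (axis 2 1 + axis 4 1)"
definition e_wt :: "real^4" where "e_wt = (1 / sqrt 2) *\<^sub>R (axis 4 1 - axis 2 1)"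

lemma null_coordinates:
  fixes x :: "real^4"
  shows "x = ((x$1 + x$3) / sqrt 2) *\<^sub>R e_z + ((x$1 - x$3) / sqrt 2) *\<^sub>R e_zt
           + ((x$2 + x$4) / sqrt 2) *\<^sub>R e_w + (- (x$2 - x$4) / sqrt 2) *\<^sub>R e_wt"
  by (simp add: vec_eq_iff forall_4 e_z_def e_zt_def e_w_def e_wt_def axis_def field_simps)

lemma matrix_inv_split_metric: "matrix_inv split_metric = split_metric"
proof -
  have sq: "split_metric ** split_metric = mat 1"
    by (simp add: vec_eq_iff forall_4 sum_4 matrix_matrix_mult_def split_metric_def mat_def)
  then have "split_metric ** matrix_inv split_metric = mat 1
      \<and> matrix_inv split_metric ** split_metric = mat 1"
    unfolding matrix_inv_def
    using someI [of "\<lambda>B. split_metric ** B = mat 1 \<and> B ** split_metric = mat 1" split_metric]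
    by blast
  then have "split_metric ** (split_metric ** matrix_inv split_metric) = split_metric"
    by simp
  then show ?thesis
    by (simp add: matrix_mul_assoc sq)
qed

text \<open>The component \<open>F(u, v)\<close> of the field strength along constant vector fields \<open>u\<close>, \<open>v\<close>.\<close>

definition field_strength_along ::
  "'n::finite gauge_potential \<Rightarrow> real^4 \<Rightarrow> real^4 \<Rightarrow> real^4 \<Rightarrow> complex^'n^'n"
  where "field_strength_along A u v x =
    (\<Sum>\<mu>\<in>UNIV. \<Sum>\<nu>\<in>UNIV. (u $ \<mu> * v $ \<nu>) *\<^sub>R field_strength A \<mu> \<nu> x)"

definition anti_self_dual_YM :: "'n::finite gauge_potential \<Rightarrow> bool"
  where "anti_self_dual_YM A \<longleftrightarrow> (\<forall>x.
    field_strength_along A e_z e_w x = 0 \<and>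
    field_strength_along A e_zt e_wt x = 0 \<and>
    field_strength_along A e_z e_zt x - field_strength_along A e_w e_wt x = 0)"

text \<open>The logarithm \<open>log (w / cnj w)\<close> in the phase of the solution is read as
  \<open>log w - log (cnj w)\<close> with conjugate values of the two logarithms, i.e. as \<open>2\<i>\<close> times the
  argument of \<open>w\<close>, so that \<open>w e\<^sup>u + cnj w e\<^sup>-\<^sup>u = 2 \<bar>w\<bar> cosh (u + log_phase w / 2)\<close>. The principal
  value \<open>Ln (w / cnj w)\<close> does not do: half of it differs from the argument (times \<open>\<i>\<close>) by an odd
  multiple of \<open>\<i>\<pi>\<close> when \<open>Re w < 0\<close>, which reverses the sign of \<open>cosh\<close>.\<close>

definition log_phase :: "complex \<Rightarrow> complex"
  where "log_phase w = Ln w - cnj (Ln w)"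

lemma exp_log_phase: "w \<noteq> 0 \<Longrightarrow> exp (log_phase w) = w / cnj w"
  by (simp add: log_phase_def exp_diff exp_cnj [symmetric])

end

theory Submission
  imports Defs
begin

text \<open>
  With \<open>u = (cnj B, cnj A, - cnj C)\<close>, which is \<open>p e\<^sup>s + q e\<^sup>-\<^sup>s\<close> at \<open>s = cnj L\<close>, and \<open>P\<close> the orthogonal
  projector onto the line of \<open>u\<close>, one has \<open>J = (lam - cnj lam) P - lam\<close>. Since \<open>u\<close> is antiholomorphic
  in \<open>L\<close>, the derivatives of \<open>P\<close> with respect to \<open>L\<close> and \<open>cnj L\<close> satisfy \<open>P P\<^sub>1 = P\<^sub>1\<close>, \<open>P\<^sub>1 P = 0\<close>, \<open>P\<^sub>2 P = P\<^sub>2\<close>,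
  \<open>P P\<^sub>2 = 0\<close> and \<open>P\<^sub>1\<^sub>2 = [P\<^sub>2, P\<^sub>1]\<close>. Hence the gauge fields are
  \<open>A\<^sub>z = (lam - cnj lam) (\<alpha> P\<^sub>1 + cnj \<alpha> P\<^sub>2)\<close> and \<open>A\<^sub>w = (lam - cnj lam) (\<beta> P\<^sub>1 + cnj \<beta> P\<^sub>2)\<close>,
  every component of the curvature is a combination of \<open>P\<^sub>1\<^sub>1 = - 2 cnj h P\<^sub>1\<close>, \<open>P\<^sub>1\<^sub>2\<close> and \<open>P\<^sub>2\<^sub>2 = - 2 h P\<^sub>2\<close>, and
  the trace reduces to \<open>4 \<bar>h\<bar>\<^sup>2 G - 2 G\<^sup>2\<close>, where \<open>h = \<partial>\<^sub>2 log \<Delta>\<close> and \<open>G = \<partial>\<^sub>1 \<partial>\<^sub>2 log \<Delta> = 4 E / \<Delta>\<^sup>2\<close>.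
\<close>

subsection \<open>Complex matrices\<close>

definition hprod :: "complex^'n \<Rightarrow> complex^'n \<Rightarrow> complex"
  where "hprod a b = (\<Sum>i\<in>UNIV. cnj (a $ i) * b $ i)"

text \<open>The rank-one operator |a><b|, matching \<open>hprod\<close> with its antilinear first
  argument.\<close>

definition outer :: "complex^'n \<Rightarrow> complex^'m \<Rightarrow> complex^'m^'n"
  where "outer a b = (\<chi> i j. a $ i * cnj (b $ j))"

definition mscale :: "complex \<Rightarrow> complex^'n^'m \<Rightarrow> complex^'n^'m"  (infixr "*\<^sub>M" 75)
  where "c *\<^sub>M M = (\<chi> i j. c * M $ i $ j)"

lemma mscale_nth [simp]: "(c *\<^sub>M M) $ i $ j = c * M $ i $ j"
  by (simp add: mscale_def)

lemma outer_nth [simp]: "outer a b $ i $ j = a $ i * cnj (b $ j)"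
  by (simp add: outer_def)

lemma dagger_nth [simp]: "dagger M $ i $ j = cnj (M $ j $ i)"
  by (simp add: dagger_def)

lemma hprod_linear:
  fixes a b c :: "complex^'n"
  shows "hprod a (b + c) = hprod a b + hprod a c" "hprod a (b - c) = hprod a b - hprod a c"
  "hprod (a + b) c = hprod a c + hprod b c" "hprod (a - b) c = hprod a c - hprod b c"
  "hprod a (z *s b) = z * hprod a b" "hprod (z *s a) b = cnj z * hprod a b"
  by (simp_all add: hprod_def sum.distrib sum_subtractf sum_distrib_left algebra_simps)

lemma cnj_hprod: "cnj (hprod a b) = hprod b a"
  by (simp add: hprod_def mult.commute)

lemma mscale_matrix_mult [simp]:
  "(c *\<^sub>M M) ** N = c *\<^sub>M (M ** N)" "M ** (c *\<^sub>M N) = c *\<^sub>M (M ** N)"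
  by (simp_all add: vec_eq_iff matrix_matrix_mult_def sum_distrib_left algebra_simps)

lemma mscale_mscale [simp]: "c *\<^sub>M d *\<^sub>M M = (c * d) *\<^sub>M M"
  by (simp add: vec_eq_iff)

lemma mscale_zero [simp]: "0 *\<^sub>M M = 0"
  by (simp add: vec_eq_iff)

lemma mscale_one [simp]: "1 *\<^sub>M M = M"
  by (simp add: vec_eq_iff)

lemma mscale_linear:
  "c *\<^sub>M (M + N) = c *\<^sub>M M + c *\<^sub>M N" "c *\<^sub>M (M - N) = c *\<^sub>M M - c *\<^sub>M N"
  "(c + d) *\<^sub>M M = c *\<^sub>M M + d *\<^sub>M M"  "(c - d) *\<^sub>M M = c *\<^sub>M M - d *\<^sub>M M"
  by (simp_all add: vec_eq_iff algebra_simps)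

lemma matrix_mult_linear:
  fixes M N K :: "complex^'n^'n"
  shows "(M + N) ** K = M ** K + N ** K" "(M - N) ** K = M ** K - N ** K"
    "K ** (M + N) = K ** M + K ** N" "K ** (M - N) = K ** M - K ** N"
  by (simp_all add: vec_eq_iff matrix_matrix_mult_def sum.distrib sum_subtractf algebra_simps)

lemma outer_mult: "outer a b ** outer c d = hprod b c *\<^sub>M outer a d"
  by (simp add: vec_eq_iff matrix_matrix_mult_def hprod_def sum_distrib_left sum_distrib_right
      mult_ac)

lemma trace_outer: "trace (outer a b) = hprod b a"
  by (simp add: trace_def hprod_def mult.commute)

lemma trace_linear:
  "trace (M + N) = trace M + trace N" "trace (M - N) = trace M - trace N"
  "trace (c *\<^sub>M M) = c * trace (M :: complex^'n^'n)"
  by (simp_all add: trace_def sum.distrib sum_subtractf sum_distrib_left)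

lemma trace_zero [simp]: "trace (0 :: complex^'n^'n) = 0"
  by (simp add: trace_def)

lemma dagger_simps:
  "dagger (M + N) = dagger M + dagger N" "dagger (M - N) = dagger M - dagger N"
  "dagger (c *\<^sub>M M) = cnj c *\<^sub>M dagger M" "dagger (outer a b) = outer b a"
  "dagger (mat c) = mat (cnj c)"
  by (auto simp add: vec_eq_iff mat_def)

lemma scaleR_eq_mscale: "r *\<^sub>R M = complex_of_real r *\<^sub>M M"
  unfolding vec_eq_iff vector_scaleR_component mscale_nth by (simp add: scaleR_conv_of_real)

lemma mat_eq_mscale: "mat z = z *\<^sub>M (mat 1 :: complex^'n^'n)"
  by (simp add: vec_eq_iff mat_def)

lemma mat_mult: "mat c ** M = c *\<^sub>M M" "M ** mat c = c *\<^sub>M M" for M :: "complex^'n^'n"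
  by (simp_all add: mat_eq_mscale [of c])

lemma matrix_inv_eqI:
  fixes M N :: "complex^'n^'n"
  assumes "N ** M = mat 1" "M ** N = mat 1"
  shows "matrix_inv M = N"
proof -
  have "M ** matrix_inv M = mat 1 \<and> matrix_inv M ** M = mat 1"
    unfolding matrix_inv_def using assms by (rule someI [of _ N, OF conjI, rotated])
  then show ?thesis
    by (metis assms(1) matrix_mul_assoc matrix_mul_lid matrix_mul_rid)
qed

section \<open>Product, quotient and chain rules along real curves\<close>

lemma bounded_bilinear_hprod: "bounded_bilinear hprod"
  unfolding bilinear_conv_bounded_bilinear [symmetric] bilinear_def
  by (auto intro!: linearI simp: hprod_def sum.distrib scaleR_sum_right algebra_simps)

lemma bounded_bilinear_outer: "bounded_bilinear outer"
  unfolding bilinear_conv_bounded_bilinear [symmetric] bilinear_def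
  by (auto intro!: linearI simp: vec_eq_iff algebra_simps)

lemma bounded_bilinear_mscale: "bounded_bilinear (*\<^sub>M)"
  unfolding bilinear_conv_bounded_bilinear [symmetric] bilinear_def
  by (auto intro!: linearI simp: vec_eq_iff algebra_simps)

lemma bounded_bilinear_smult: "bounded_bilinear ((*s) :: complex \<Rightarrow> complex^'n \<Rightarrow> _)"
  unfolding bilinear_conv_bounded_bilinear [symmetric] bilinear_def
  by (auto intro!: linearI simp: vec_eq_iff algebra_simps)

text \<open>\<open>hprod\<close> and \<open>outer\<close> are conjugate-linear in one argument, so
  the product rule rests on real bilinearity. This suffices because all derivatives are taken along
  curves with a real parameter.\<close>

lemmas vderiv_hprod = bounded_bilinear.has_vector_derivative [OF bounded_bilinear_hprod]
lemmas vderiv_outer = bounded_bilinear.has_vector_derivative [OF bounded_bilinear_outer]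
lemmas vderiv_mscale = bounded_bilinear.has_vector_derivative [OF bounded_bilinear_mscale]
lemmas vderiv_smult = bounded_bilinear.has_vector_derivative [OF bounded_bilinear_smult]

text \<open>The result keeps the quotient \<open>f t / g t\<close> visible, so that in
  \<open>vderiv_h\<close> it folds back into \<open>h\<close>.\<close>

lemma vderiv_divide:
  fixes f g :: "real \<Rightarrow> complex"
  assumes "(f has_vector_derivative f') (at t)" "(g has_vector_derivative g') (at t)" "g t \<noteq> 0"
  shows "((\<lambda>t. f t / g t) has_vector_derivative (f' - f t / g t * g') / g t) (at t)"
proof -
  have "((\<lambda>t. inverse (g t)) has_vector_derivative - (inverse (g t) * g' * inverse (g t))) (at t)"
    using Deriv.has_derivative_inverse [OF assms(3) assms(2)[unfolded has_vector_derivative_def]]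
    by (simp add: has_vector_derivative_def algebra_simps)
  then have "((\<lambda>t. f t * inverse (g t)) has_vector_derivative
      f t * (- (inverse (g t) * g' * inverse (g t))) + f' * inverse (g t)) (at t)"
    by (rule has_vector_derivative_mult [OF assms(1)])
  moreover have "f t * (- (inverse (g t) * g' * inverse (g t))) + f' * inverse (g t)
      = (f' - f t / g t * g') / g t"
    using assms(3) by (simp add: field_simps)
  ultimately show ?thesis
    by (simp add: divide_inverse)
qed

lemma vderiv_exp:
  fixes f :: "real \<Rightarrow> complex"
  assumes "(f has_vector_derivative f') (at t)"
  shows "((\<lambda>t. exp (f t)) has_vector_derivative f' * exp (f t)) (at t)"
  using field_vector_diff_chain_at [OF assms DERIV_exp] by (simp add: o_def)

lemma cnj_exp: "cnj (exp s) = exp (cnj s)"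
  by (simp add: exp_cnj)

subsection \<open>Projectors onto exponential lines\<close>

text \<open>
  For a potential with components \<open>g P\<^sub>1 + cnj g P\<^sub>2\<close> in the direction in which \<open>L\<close> has derivative \<open>c\<close>
  (and \<open>g'\<close>, \<open>c'\<close> in a second direction), these are the coefficients of \<open>P\<^sub>1\<^sub>1\<close> and \<open>P\<^sub>1\<^sub>2\<close> in the
  curvature; the last term of the second one comes from \<open>[P\<^sub>1, P\<^sub>2] = - P\<^sub>1\<^sub>2\<close>.
\<close>

definition curv_hol :: "complex \<Rightarrow> complex \<Rightarrow> complex \<Rightarrow> complex \<Rightarrow> complex"
  where "curv_hol g c g' c' = g' * c - g * c'"

definition curv_mixed :: "complex \<Rightarrow> complex \<Rightarrow> complex \<Rightarrow> complex \<Rightarrow> complex \<Rightarrow> complex"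
  where "curv_mixed \<kappa> g c g' c' = g' * cnj c + cnj g' * c - g * cnj c' - cnj g * c'
    - \<kappa> * (g * cnj g' - cnj g * g')"

text \<open>
  \<open>P\<close> is the orthogonal projector onto the line spanned by \<open>U\<close>. The subscripts 1 and 2 denote the
  Wirtinger derivatives with respect to \<open>s\<close> and \<open>cnj s\<close>, and \<open>h\<close>, \<open>G\<close> are the derivatives
  \<open>\<partial>\<^sub>2 log \<Delta>\<close>, \<open>\<partial>\<^sub>1 \<partial>\<^sub>2 log \<Delta>\<close>.
\<close>

locale exp_line =
  fixes p q :: "complex^'n"
  assumes indep: "exp (cnj s) *s p + exp (- cnj s) *s q \<noteq> 0"
begin

definition "U s = exp (cnj s) *s p + exp (- cnj s) *s q"
text \<open>The derivative of \<open>U\<close> with respect to \<open>cnj s\<close>.\<close>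

definition "V s = exp (cnj s) *s p - exp (- cnj s) *s q"
definition "\<Delta> s = hprod (U s) (U s)"
definition "h s = hprod (U s) (V s) / \<Delta> s"
text \<open>The component of \<open>V\<close> orthogonal to \<open>U\<close>. Only this component
  moves the line spanned by \<open>U\<close>, so it alone enters the derivatives of
  \<open>P\<close>.\<close>

definition "W s = V s - h s *s U s"
definition "G s = hprod (W s) (W s) / \<Delta> s"
definition "P s = (1 / \<Delta> s) *\<^sub>M outer (U s) (U s)"
definition "P\<^sub>1 s = (1 / \<Delta> s) *\<^sub>M outer (U s) (W s)"
definition "P\<^sub>2 s = (1 / \<Delta> s) *\<^sub>M outer (W s) (U s)"
definition "P\<^sub>1\<^sub>2 s = (1 / \<Delta> s) *\<^sub>M outer (W s) (W s) - G s *\<^sub>M P s"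

section \<open>Algebra of the projector and its derivatives\<close>

lemma \<Delta>_nz: "\<Delta> s \<noteq> 0"
proof
  assume "\<Delta> s = 0"
  then have "complex_of_real (\<Sum>i\<in>UNIV. (cmod (U s $ i))\<^sup>2) = 0"
    unfolding \<Delta>_def hprod_def of_real_sum complex_norm_square by (simp add: mult.commute)
  then have "(\<Sum>i\<in>UNIV. (cmod (U s $ i))\<^sup>2) = 0"
    by (simp only: of_real_eq_0_iff)
  then have "U s = 0"
    by (simp add: sum_nonneg_eq_0_iff vec_eq_iff)
  with indep [of s] show False
    by (simp add: U_def)
qed

lemma cnj_\<Delta>: "cnj (\<Delta> s) = \<Delta> s"
  by (simp add: \<Delta>_def cnj_hprod)

lemma hprod_UW: "hprod (U s) (W s) = 0" and hprod_WU: "hprod (W s) (U s) = 0"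
proof -
  show "hprod (U s) (W s) = 0"
    using \<Delta>_nz [of s] by (simp add: W_def hprod_linear h_def flip: \<Delta>_def)
  then show "hprod (W s) (U s) = 0"
    by (metis cnj_hprod complex_cnj_zero)
qed

lemma hprod_UU: "hprod (U s) (U s) = \<Delta> s"
  by (simp add: \<Delta>_def)

lemma hprod_WW: "hprod (W s) (W s) = G s * \<Delta> s"
  using \<Delta>_nz by (simp add: G_def)

lemma cnj_G: "cnj (G s) = G s"
  by (simp add: G_def cnj_hprod cnj_\<Delta>)

text \<open>Pythagoras for the orthogonal decomposition \<open>V = W + h U\<close>, divided by
  \<open>\<Delta>\<close>.\<close>

lemma G_altdef: "G s = hprod (V s) (V s) / \<Delta> s - h s * cnj (h s)"
proof -
  have "hprod (W s) (W s) = hprod (W s) (V s) - h s * hprod (W s) (U s)"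
    by (subst (2) W_def) (simp only: hprod_linear)
  also have "\<dots> = hprod (V s) (V s) - cnj (h s) * hprod (U s) (V s)"
    unfolding hprod_WU by (subst W_def) (simp add: hprod_linear)
  also have "hprod (U s) (V s) = h s * \<Delta> s"
    using \<Delta>_nz [of s] by (simp add: h_def)
  finally show ?thesis
    using \<Delta>_nz [of s] by (simp add: G_def diff_divide_distrib)
qed

lemmas hprods = hprod_UU hprod_WW hprod_UW hprod_WU

text \<open>Since \<open>U\<close> and \<open>W\<close> are orthogonal, a product survives only when
  equal vectors meet in the middle. The products of \<open>P\<^sub>1\<close> and
  \<open>P\<^sub>2\<close> give \<open>[P\<^sub>2, P\<^sub>1] = P\<^sub>1\<^sub>2\<close>, which
  closes the commutators.\<close>

lemma mult_table:
  "P s ** P s = P s" "P s ** P\<^sub>1 s = P\<^sub>1 s" "P s ** P\<^sub>2 s = 0"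
  "P\<^sub>1 s ** P s = 0" "P\<^sub>2 s ** P s = P\<^sub>2 s"
  "P\<^sub>1 s ** P\<^sub>1 s = 0" "P\<^sub>2 s ** P\<^sub>2 s = 0" "P\<^sub>1 s ** P\<^sub>2 s = G s *\<^sub>M P s"
  "P\<^sub>2 s ** P\<^sub>1 s = P\<^sub>1\<^sub>2 s + G s *\<^sub>M P s"
  using \<Delta>_nz [of s] unfolding P_def P\<^sub>1_def P\<^sub>2_def P\<^sub>1\<^sub>2_def
  by (simp_all add: outer_mult hprods vec_eq_iff)

lemma traces:
  "trace (P s) = 1" "trace (P\<^sub>1 s) = 0" "trace (P\<^sub>2 s) = 0" "trace (P\<^sub>1\<^sub>2 s) = 0"
  using \<Delta>_nz [of s] unfolding P_def P\<^sub>1_def P\<^sub>2_def P\<^sub>1\<^sub>2_def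
  by (simp_all add: trace_linear trace_outer hprods)

text \<open>\<open>P\<^sub>1\<^sub>2\<close> acts as \<open>- G\<close> on \<open>U\<close> and as
  \<open>G\<close> on \<open>W\<close>, hence the trace \<open>2 G\<^sup>2\<close> of its square.
  \<open>P\<^sub>1\<close> and \<open>P\<^sub>2\<close> map one of these lines into the other, so
  their products with \<open>P\<^sub>1\<^sub>2\<close> are traceless.\<close>

lemma traces_mult:
  "trace (P\<^sub>1 s ** P\<^sub>2 s) = G s" "trace (P\<^sub>2 s ** P\<^sub>1 s) = G s"
  "trace (P\<^sub>1 s ** P\<^sub>1 s) = 0" "trace (P\<^sub>2 s ** P\<^sub>2 s) = 0"
  "trace (P\<^sub>1 s ** P\<^sub>1\<^sub>2 s) = 0" "trace (P\<^sub>1\<^sub>2 s ** P\<^sub>1 s) = 0"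
  "trace (P\<^sub>2 s ** P\<^sub>1\<^sub>2 s) = 0" "trace (P\<^sub>1\<^sub>2 s ** P\<^sub>2 s) = 0"
  "trace (P\<^sub>1\<^sub>2 s ** P\<^sub>1\<^sub>2 s) = 2 * (G s)\<^sup>2"
  using \<Delta>_nz [of s] unfolding P_def P\<^sub>1_def P\<^sub>2_def P\<^sub>1\<^sub>2_def
  by (simp_all add: trace_linear trace_outer hprods outer_mult matrix_mult_linear power2_eq_square)

lemma daggers: "dagger (P s) = P s" "dagger (P\<^sub>1 s) = P\<^sub>2 s" "dagger (P\<^sub>2 s) = P\<^sub>1 s"
  unfolding P_def P\<^sub>1_def P\<^sub>2_def by (simp_all add: dagger_simps cnj_\<Delta>)

section \<open>Derivatives of the projector along a curve of phases\<close>

context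
  fixes l :: "real \<Rightarrow> complex" and k :: complex and t :: real
  assumes l: "(l has_vector_derivative k) (at t)"
begin

text \<open>Both vectors are antiholomorphic in the phase, so only \<open>cnj k\<close> occurs, and
  differentiation with respect to \<open>cnj s\<close> exchanges them.\<close>

lemma vderiv_U: "((\<lambda>t. U (l t)) has_vector_derivative cnj k *s V (l t)) (at t)"
  and vderiv_V: "((\<lambda>t. V (l t)) has_vector_derivative cnj k *s U (l t)) (at t)"
proof -
  have e: "((\<lambda>t. exp (cnj (l t)) *s p) has_vector_derivative (cnj k * exp (cnj (l t))) *s p) (at t)"
    using vderiv_smult [OF vderiv_exp [OF has_vector_derivative_cnj [OF l]] has_vector_derivative_const [of p]]
    by simp
  have f: "((\<lambda>t. exp (- cnj (l t)) *s q) has_vector_derivative (- cnj k * exp (- cnj (l t))) *s q) (at t)"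
    using vderiv_smult [OF vderiv_exp [OF has_vector_derivative_minus [OF has_vector_derivative_cnj [OF l]]] has_vector_derivative_const [of q]]
    by simp
  show "((\<lambda>t. U (l t)) has_vector_derivative cnj k *s V (l t)) (at t)"
    using has_vector_derivative_add [OF e f] unfolding U_def V_def
    by (rule has_vector_derivative_eq_rhs) (simp add: vec_eq_iff algebra_simps)
  show "((\<lambda>t. V (l t)) has_vector_derivative cnj k *s U (l t)) (at t)"
    using has_vector_derivative_diff [OF e f] unfolding U_def V_def
    by (rule has_vector_derivative_eq_rhs) (simp add: vec_eq_iff algebra_simps)
qed

lemma vderiv_\<Delta>: "((\<lambda>t. \<Delta> (l t)) has_vector_derivative \<Delta> (l t) * (k * cnj (h (l t)) + cnj k * h (l t))) (at t)"
  unfolding \<Delta>_def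
  by (rule has_vector_derivative_eq_rhs [OF vderiv_hprod [OF vderiv_U vderiv_U]])
    (use \<Delta>_nz [of "l t"] in \<open>simp add: hprod_linear h_def cnj_hprod cnj_\<Delta> hprod_UU field_simps\<close>)

text \<open>The numerator \<open>hprod U V\<close> has derivatives \<open>hprod V V\<close> in
  \<open>s\<close> and \<open>\<Delta>\<close> in \<open>cnj s\<close>. Subtracting \<open>h\<close>
  times the logarithmic derivative of \<open>\<Delta>\<close> leaves \<open>G\<close>, by
  \<open>G_altdef\<close>, and \<open>1 - h\<^sup>2\<close>.\<close>

lemma vderiv_h: "((\<lambda>t. h (l t)) has_vector_derivative k * G (l t) + cnj k * (1 - (h (l t))\<^sup>2)) (at t)"
proof -
  have "((\<lambda>t. hprod (U (l t)) (V (l t)) / \<Delta> (l t)) has_vector_derivative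
      (k * hprod (V (l t)) (V (l t)) + cnj k * \<Delta> (l t)
        - h (l t) * (\<Delta> (l t) * (k * cnj (h (l t)) + cnj k * h (l t)))) / \<Delta> (l t)) (at t)"
    using vderiv_divide [OF vderiv_hprod [OF vderiv_U vderiv_V] vderiv_\<Delta> \<Delta>_nz]
    by (rule has_vector_derivative_eq_rhs) (simp add: hprod_linear h_def [symmetric] hprod_UU)
  then show ?thesis
    unfolding h_def [symmetric]
    by (rule has_vector_derivative_eq_rhs)
      (use \<Delta>_nz [of "l t"] in \<open>simp add: G_altdef power2_eq_square
        add_divide_distrib diff_divide_distrib algebra_simps\<close>)
qed

lemma vderiv_W: "((\<lambda>t. W (l t)) has_vector_derivative
    - (cnj k * h (l t)) *s W (l t) - (k * G (l t)) *s U (l t)) (at t)"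
proof -
  have "((\<lambda>t. V (l t) - h (l t) *s U (l t)) has_vector_derivative
     cnj k *s U (l t) - (h (l t) *s (cnj k *s V (l t))
       + (k * G (l t) + cnj k * (1 - (h (l t))\<^sup>2)) *s U (l t))) (at t)"
    by (intro has_vector_derivative_diff vderiv_V vderiv_smult vderiv_h vderiv_U)
  then show ?thesis
    unfolding W_def by (rule has_vector_derivative_eq_rhs)
     (simp add: vec_eq_iff algebra_simps power2_eq_square)
qed

lemma vderiv_inverse_\<Delta>: "((\<lambda>t. 1 / \<Delta> (l t)) has_vector_derivative
    - (k * cnj (h (l t)) + cnj k * h (l t)) / \<Delta> (l t)) (at t)"
  using vderiv_divide [OF has_vector_derivative_const [of 1] vderiv_\<Delta> \<Delta>_nz]
  by (rule has_vector_derivative_eq_rhs) (use \<Delta>_nz [of "l t"] in \<open>simp add: field_simps\<close>)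

lemma V_eq: "V s = W s + h s *s U s"
  by (simp add: W_def)

text \<open>After splitting \<open>V = W + h U\<close>, the parts along \<open>U\<close> cancel
  against the derivative of \<open>1 / \<Delta>\<close>.\<close>

lemma vderiv_P: "((\<lambda>t. P (l t)) has_vector_derivative k *\<^sub>M P\<^sub>1 (l t) + cnj k *\<^sub>M P\<^sub>2 (l t)) (at t)"
  unfolding P_def P\<^sub>1_def P\<^sub>2_def
  by (rule has_vector_derivative_eq_rhs [OF vderiv_mscale [OF vderiv_inverse_\<Delta> vderiv_outer [OF vderiv_U vderiv_U]]])
    (use \<Delta>_nz [of "l t"] in \<open>simp add: vec_eq_iff V_eq field_simps\<close>)

text \<open>With respect to \<open>s\<close> the vector \<open>U\<close> is constant, while
  \<open>1 / \<Delta>\<close> and the conjugate of \<open>W\<close> each contribute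
  \<open>- cnj h\<close>; hence the factor 2.\<close>

lemma vderiv_P\<^sub>1: "((\<lambda>t. P\<^sub>1 (l t)) has_vector_derivative
    (- 2 * k * cnj (h (l t))) *\<^sub>M P\<^sub>1 (l t) + cnj k *\<^sub>M P\<^sub>1\<^sub>2 (l t)) (at t)"
  unfolding P\<^sub>1\<^sub>2_def P_def P\<^sub>1_def P\<^sub>2_def
  by (rule has_vector_derivative_eq_rhs [OF vderiv_mscale [OF vderiv_inverse_\<Delta> vderiv_outer [OF vderiv_U vderiv_W]]])
    (use \<Delta>_nz [of "l t"] in \<open>simp add: vec_eq_iff V_eq cnj_G field_simps\<close>)

lemma vderiv_P\<^sub>2: "((\<lambda>t. P\<^sub>2 (l t)) has_vector_derivative
    (- 2 * cnj k * h (l t)) *\<^sub>M P\<^sub>2 (l t) + k *\<^sub>M P\<^sub>1\<^sub>2 (l t)) (at t)"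
  unfolding P\<^sub>1\<^sub>2_def P_def P\<^sub>1_def P\<^sub>2_def
  by (rule has_vector_derivative_eq_rhs [OF vderiv_mscale [OF vderiv_inverse_\<Delta> vderiv_outer [OF vderiv_W vderiv_U]]])
    (use \<Delta>_nz [of "l t"] in \<open>simp add: vec_eq_iff V_eq cnj_G field_simps\<close>)

end

section \<open>Closed forms in terms of exponentials\<close>

lemma
  shows \<Delta>_eq: "\<Delta> s = exp (cnj s) * exp s * hprod p p + exp s * exp (- cnj s) * hprod p q
      + exp (cnj s) * exp (- s) * hprod q p + exp (- s) * exp (- cnj s) * hprod q q" (is ?D)
    and hprod_UV: "hprod (U s) (V s) = exp (cnj s) * exp s * hprod p p
      - exp s * exp (- cnj s) * hprod p q
      + exp (cnj s) * exp (- s) * hprod q p - exp (- s) * exp (- cnj s) * hprod q q" (is ?N)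
    and hprod_VV: "hprod (V s) (V s) = exp (cnj s) * exp s * hprod p p
      - exp s * exp (- cnj s) * hprod p q
      - exp (cnj s) * exp (- s) * hprod q p + exp (- s) * exp (- cnj s) * hprod q q" (is ?M)
proof -
  have c: "cnj (exp (cnj s)) = exp s" "cnj (exp (- cnj s)) = exp (- s)"
    by (simp_all only: cnj_exp complex_cnj_cnj complex_cnj_minus)
  show ?D ?N ?M
    unfolding \<Delta>_def U_def V_def hprod_linear c by (simp_all only: algebra_simps)
qed

text \<open>\<open>G \<Delta>\<^sup>2\<close> is the Gram determinant of \<open>U\<close> and
  \<open>V\<close>. Passing from \<open>p\<close>, \<open>q\<close> to \<open>U\<close>,
  \<open>V\<close> has determinant -2, whose squared modulus gives the factor 4.\<close>

lemma G_eq: "G s = 4 * (hprod p p * hprod q q - hprod p q * hprod q p) / (\<Delta> s)\<^sup>2"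
proof -
  define e f ec fc where ef_defs: "e = exp (cnj s)" "f = exp (- cnj s)" "ec = exp s" "fc = exp (- s)"
  have ef: "e * f = 1" "ec * fc = 1"
    unfolding ef_defs by (simp_all add: exp_minus)
  have c: "cnj e = ec" "cnj f = fc"
    unfolding ef_defs by (simp_all only: cnj_exp complex_cnj_cnj complex_cnj_minus)
  have "cnj (hprod (U s) (V s)) = e * ec * hprod p p - e * fc * hprod q p
      + ec * f * hprod p q - f * fc * hprod q q"
    unfolding hprod_UV ef_defs [symmetric] complex_cnj_add complex_cnj_diff complex_cnj_mult cnj_hprod c
    by (simp add: c [symmetric])
  then have VU: "hprod (V s) (U s) = e * ec * hprod p p - e * fc * hprod q p
      + ec * f * hprod p q - f * fc * hprod q q"
    by (simp add: cnj_hprod)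
  have "G s * (\<Delta> s)\<^sup>2
      = hprod (V s) (V s) * \<Delta> s - hprod (V s) (U s) * hprod (U s) (V s)"
    using \<Delta>_nz [of s]
    by (simp add: G_altdef h_def cnj_hprod cnj_\<Delta> power2_eq_square left_diff_distrib)
  also have "\<dots> = 4 * (e * f) * (ec * fc) * (hprod p p * hprod q q - hprod p q * hprod q p)"
    unfolding \<Delta>_eq hprod_UV hprod_VV VU ef_defs [symmetric] by algebra
  finally show ?thesis
    using ef \<Delta>_nz [of s] by (simp add: field_simps)
qed

text \<open>The chain rule for functions of the phase alone. \<open>f\<close> need not be
  holomorphic, so its derivative is given as a function \<open>D\<close> of the velocity
  \<open>c\<close> instead of a complex multiple of \<open>c\<close>.\<close>

lemma partial_deriv_along_phase:
  fixes k :: "'d::finite \<Rightarrow> complex" and f :: "complex \<Rightarrow> 'b::real_normed_vector"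
  assumes "\<And>l c t. (l has_vector_derivative c) (at t)
      \<Longrightarrow> ((\<lambda>t. f (l t)) has_vector_derivative D c (l t)) (at t)"
  shows "partial_deriv \<mu> (\<lambda>x. f (\<Sum>\<nu>\<in>UNIV. k \<nu> * complex_of_real (x $ \<nu>))) x
    = D (k \<mu>) (\<Sum>\<nu>\<in>UNIV. k \<nu> * complex_of_real (x $ \<nu>))"
proof -
  define L where "L x = (\<Sum>\<nu>\<in>UNIV. k \<nu> * complex_of_real (x $ \<nu>))" for x
  have L: "L (x + t *\<^sub>R axis \<mu> 1) = L x + of_real t * k \<mu>" for t
  proof -
    have "L (x + t *\<^sub>R axis \<mu> 1)
        = L x + (\<Sum>\<nu>\<in>UNIV. if \<nu> = \<mu> then of_real t * k \<nu> else 0)"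
      unfolding L_def sum.distrib [symmetric]
      by (rule sum.cong) (simp_all add: axis_def algebra_simps)
    then show ?thesis
      by simp
  qed
  have "((\<lambda>t. L (x + t *\<^sub>R axis \<mu> 1)) has_vector_derivative k \<mu>) (at 0)"
    unfolding L by (auto intro!: derivative_eq_intros)
  from assms [OF this]
  have "vector_derivative (\<lambda>t. f (L (x + t *\<^sub>R axis \<mu> 1))) (at 0) = D (k \<mu>) (L x)"
    by (simp add: vector_derivative_at)
  then show ?thesis
    unfolding partial_deriv_def L_def .
qed

section \<open>Field strength of a potential spanned by \<open>P\<^sub>1\<close> and
  \<open>P\<^sub>2\<close>\<close>

context
  fixes k \<gamma> :: "4 \<Rightarrow> complex" and \<kappa> :: complex
    and L :: "real^4 \<Rightarrow> complex" and \<A> :: "'n gauge_potential"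
  assumes L: "L x = (\<Sum>\<mu>\<in>UNIV. k \<mu> * complex_of_real (x $ \<mu>))"
    and \<A>: "\<A> \<mu> x = \<kappa> *\<^sub>M (\<gamma> \<mu> *\<^sub>M P\<^sub>1 (L x) + cnj (\<gamma> \<mu>) *\<^sub>M P\<^sub>2 (L x))"
begin

lemma partial_deriv_potential:
  "partial_deriv \<mu> (\<A> \<nu>) x
    = (- 2 * \<kappa> * cnj (h (L x)) * (\<gamma> \<nu> * k \<mu>)) *\<^sub>M P\<^sub>1 (L x)
    + (- 2 * \<kappa> * h (L x) * cnj (\<gamma> \<nu> * k \<mu>)) *\<^sub>M P\<^sub>2 (L x)
    + (\<kappa> * (\<gamma> \<nu> * cnj (k \<mu>) + cnj (\<gamma> \<nu>) * k \<mu>)) *\<^sub>M P\<^sub>1\<^sub>2 (L x)"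
proof -
  have *: "\<A> \<nu> = (\<lambda>x. (\<lambda>s. \<kappa> *\<^sub>M (\<gamma> \<nu> *\<^sub>M P\<^sub>1 s + cnj (\<gamma> \<nu>) *\<^sub>M P\<^sub>2 s))
      (\<Sum>\<mu>\<in>UNIV. k \<mu> * complex_of_real (x $ \<mu>)))"
    by (simp add: \<A> L fun_eq_iff)
  show ?thesis
    unfolding * L
  proof (rule trans [OF partial_deriv_along_phase])
    fix l :: "real \<Rightarrow> complex" and c t
    assume l: "(l has_vector_derivative c) (at t)"
    show "((\<lambda>t. \<kappa> *\<^sub>M (\<gamma> \<nu> *\<^sub>M P\<^sub>1 (l t) + cnj (\<gamma> \<nu>) *\<^sub>M P\<^sub>2 (l t))) has_vector_derivative
      \<kappa> *\<^sub>M (\<gamma> \<nu> *\<^sub>M ((- 2 * c * cnj (h (l t))) *\<^sub>M P\<^sub>1 (l t) + cnj c *\<^sub>M P\<^sub>1\<^sub>2 (l t))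
        + cnj (\<gamma> \<nu>) *\<^sub>M ((- 2 * cnj c * h (l t)) *\<^sub>M P\<^sub>2 (l t) + c *\<^sub>M P\<^sub>1\<^sub>2 (l t)))) (at t)"
      by (intro bounded_linear.has_vector_derivative
          [OF bounded_bilinear.bounded_linear_right [OF bounded_bilinear_mscale]]
          has_vector_derivative_add vderiv_P\<^sub>1 vderiv_P\<^sub>2 l)
  qed (simp add: vec_eq_iff algebra_simps)
qed

lemma commutator_potential:
  "commutator (\<A> \<mu> x) (\<A> \<nu> x)
    = (- (\<kappa>\<^sup>2 * (\<gamma> \<mu> * cnj (\<gamma> \<nu>) - cnj (\<gamma> \<mu>) * \<gamma> \<nu>))) *\<^sub>M P\<^sub>1\<^sub>2 (L x)"
  by (simp add: commutator_def \<A> matrix_mult_linear mult_table mscale_linear)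
    (simp add: vec_eq_iff algebra_simps power2_eq_square)

lemma field_strength_potential:
  "field_strength \<A> \<mu> \<nu> x
    = (- 2 * \<kappa> * cnj (h (L x)) * curv_hol (\<gamma> \<mu>) (k \<mu>) (\<gamma> \<nu>) (k \<nu>)) *\<^sub>M P\<^sub>1 (L x)
    + (- 2 * \<kappa> * h (L x) * cnj (curv_hol (\<gamma> \<mu>) (k \<mu>) (\<gamma> \<nu>) (k \<nu>))) *\<^sub>M P\<^sub>2 (L x)
    + (\<kappa> * curv_mixed \<kappa> (\<gamma> \<mu>) (k \<mu>) (\<gamma> \<nu>) (k \<nu>)) *\<^sub>M P\<^sub>1\<^sub>2 (L x)"
  unfolding field_strength_def partial_deriv_potential commutator_potential curv_hol_def curv_mixed_def
  by (simp add: vec_eq_iff algebra_simps power2_eq_square)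

text \<open>\<open>curv_hol\<close> and \<open>curv_mixed\<close> are real-bilinear in the pairs of
  coefficients of the two directions, so contraction with the real vectors \<open>u\<close>,
  \<open>v\<close> passes to their arguments.\<close>

lemma field_strength_along_potential:
  fixes u v :: "real^4"
  defines "d \<equiv> \<lambda>g u. \<Sum>\<mu>\<in>UNIV. complex_of_real (u $ \<mu>) * g \<mu>"
  shows "field_strength_along \<A> u v x
    = (- 2 * \<kappa> * cnj (h (L x)) * curv_hol (d \<gamma> u) (d k u) (d \<gamma> v) (d k v)) *\<^sub>M P\<^sub>1 (L x)
    + (- 2 * \<kappa> * h (L x) * cnj (curv_hol (d \<gamma> u) (d k u) (d \<gamma> v) (d k v))) *\<^sub>M P\<^sub>2 (L x)
    + (\<kappa> * curv_mixed \<kappa> (d \<gamma> u) (d k u) (d \<gamma> v) (d k v)) *\<^sub>M P\<^sub>1\<^sub>2 (L x)"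
proof -
  define w where "w \<mu> \<nu> = complex_of_real (u $ \<mu>) * complex_of_real (v $ \<nu>)" for \<mu> \<nu>
  have 1: "curv_hol (d \<gamma> u) (d k u) (d \<gamma> v) (d k v)
      = (\<Sum>\<mu>\<in>UNIV. \<Sum>\<nu>\<in>UNIV. w \<mu> \<nu> * curv_hol (\<gamma> \<mu>) (k \<mu>) (\<gamma> \<nu>) (k \<nu>))"
    unfolding curv_hol_def d_def w_def sum_4 by algebra
  have 2: "curv_mixed \<kappa> (d \<gamma> u) (d k u) (d \<gamma> v) (d k v)
      = (\<Sum>\<mu>\<in>UNIV. \<Sum>\<nu>\<in>UNIV. w \<mu> \<nu> * curv_mixed \<kappa> (\<gamma> \<mu>) (k \<mu>) (\<gamma> \<nu>) (k \<nu>))"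
    unfolding curv_mixed_def d_def w_def sum_4
      complex_cnj_add complex_cnj_mult complex_cnj_complex_of_real by algebra
  show ?thesis
    unfolding 1 2 field_strength_along_def field_strength_potential scaleR_eq_mscale
      vec_eq_iff sum_component vector_add_component mscale_nth cnj_sum
      sum_distrib_left sum_distrib_right sum.distrib [symmetric]
    by (intro allI sum.cong refl) (simp add: w_def algebra_simps)
qed

lemma tr_F_F_potential:
  defines "\<eta> \<equiv> \<lambda>\<mu>. complex_of_real (split_metric $ \<mu> $ \<mu>)"
  shows "tr_F_F \<A> x = (\<Sum>\<mu>\<in>UNIV. \<Sum>\<nu>\<in>UNIV. \<eta> \<mu> * \<eta> \<nu> *
    (8 * \<kappa>\<^sup>2 * (h (L x) * cnj (h (L x))) * G (L x)
        * (curv_hol (\<gamma> \<mu>) (k \<mu>) (\<gamma> \<nu>) (k \<nu>) * cnj (curv_hol (\<gamma> \<mu>) (k \<mu>) (\<gamma> \<nu>) (k \<nu>)))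
      + 2 * \<kappa>\<^sup>2 * (G (L x))\<^sup>2 * (curv_mixed \<kappa> (\<gamma> \<mu>) (k \<mu>) (\<gamma> \<nu>) (k \<nu>))\<^sup>2))"
proof -
  have upper: "field_strength_upper \<A> \<mu> \<nu> x = (\<eta> \<mu> * \<eta> \<nu>) *\<^sub>M field_strength \<A> \<mu> \<nu> x" for \<mu> \<nu>
  proof -
    have *: "split_metric $ \<mu> $ \<rho> = (if \<rho> = \<mu> then split_metric $ \<mu> $ \<mu> else 0)" for \<mu> \<rho>
      by (simp add: split_metric_def)
    have "field_strength_upper \<A> \<mu> \<nu> x = (\<Sum>\<rho>\<in>UNIV. \<Sum>\<sigma>\<in>UNIV. if \<sigma> = \<nu> then
        (if \<rho> = \<mu> then (\<eta> \<mu> * \<eta> \<nu>) *\<^sub>M field_strength \<A> \<rho> \<sigma> x else 0) else 0)"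
      unfolding field_strength_upper_def matrix_inv_split_metric
      by (intro sum.cong refl, subst (1 2) *) (simp add: \<eta>_def scaleR_eq_mscale)
    then show ?thesis
      by simp
  qed
  \<comment> \<open>By \<open>traces_mult\<close> only the products of \<open>P\<^sub>1\<close> with
    \<open>P\<^sub>2\<close> and the square of \<open>P\<^sub>1\<^sub>2\<close> contribute. The
    metric being diagonal, raising both indices only multiplies by signs, so a square is all that is
    needed.\<close>
  have "trace (M ** M) = 2 * a * b * G s + 2 * c\<^sup>2 * (G s)\<^sup>2"
    if "M = a *\<^sub>M P\<^sub>1 s + b *\<^sub>M P\<^sub>2 s + c *\<^sub>M P\<^sub>1\<^sub>2 s" for a b c s M
    unfolding that by (simp add: matrix_mult_linear trace_linear traces_mult power2_eq_square)
  note * = this [OF field_strength_potential]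
  show ?thesis
    unfolding tr_F_F_def upper mscale_matrix_mult trace_linear *
    by (intro sum.cong refl) (simp add: algebra_simps power2_eq_square)
qed

end

section \<open>The matrix \<open>J\<close> and its logarithmic derivative\<close>

context
  fixes lam :: complex
  assumes lam: "lam \<noteq> 0"
begin

text \<open>\<open>J\<close> acts as \<open>- cnj lam\<close> on the line of \<open>U\<close> and as
  \<open>- lam\<close> on its orthogonal complement, hence is \<open>cmod lam\<close> times a
  unitary matrix.\<close>

definition "J s = (lam - cnj lam) *\<^sub>M P s - mat lam"

lemma dagger_J: "dagger (J s) ** J s = mat (complex_of_real ((cmod lam)\<^sup>2))"
  and J_dagger: "J s ** dagger (J s) = mat (complex_of_real ((cmod lam)\<^sup>2))"
proof -
  show "dagger (J s) ** J s = mat (complex_of_real ((cmod lam)\<^sup>2))"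
    "J s ** dagger (J s) = mat (complex_of_real ((cmod lam)\<^sup>2))"
    unfolding J_def mat_eq_mscale [of lam] mat_eq_mscale [of "complex_of_real ((cmod lam)\<^sup>2)"] complex_norm_square
    by (simp_all add: matrix_mult_linear mult_table mscale_linear dagger_simps daggers)
      (simp_all add: vec_eq_iff mat_eq_mscale [of "lam * cnj lam"] algebra_simps)
qed

text \<open>The same spectral form with reciprocal eigenvalues.\<close>

lemma matrix_inv_J: "matrix_inv (J s) = (1 / lam - 1 / cnj lam) *\<^sub>M P s - mat (1 / lam)"
proof (rule matrix_inv_eqI)
  show "((1 / lam - 1 / cnj lam) *\<^sub>M P s - mat (1 / lam)) ** J s = mat 1"
    "J s ** ((1 / lam - 1 / cnj lam) *\<^sub>M P s - mat (1 / lam)) = mat 1"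
    unfolding J_def mat_eq_mscale [of lam] mat_eq_mscale [of "1 / lam"] using lam
    by (simp_all add: matrix_mult_linear mult_table mscale_linear)
      (simp_all add: vec_eq_iff field_simps)
qed

lemma partial_deriv_J:
  fixes k :: "'d::finite \<Rightarrow> complex"
  assumes L: "\<And>x. L x = (\<Sum>\<mu>\<in>UNIV. k \<mu> * complex_of_real (x $ \<mu>))"
  shows "partial_deriv \<mu> (\<lambda>x. J (L x)) x
    = (lam - cnj lam) *\<^sub>M (k \<mu> *\<^sub>M P\<^sub>1 (L x) + cnj (k \<mu>) *\<^sub>M P\<^sub>2 (L x))"
  unfolding L
proof (rule partial_deriv_along_phase)
  fix l :: "real \<Rightarrow> complex" and c t
  assume l: "(l has_vector_derivative c) (at t)"
  show "((\<lambda>t. J (l t)) has_vector_derivative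
      (lam - cnj lam) *\<^sub>M (c *\<^sub>M P\<^sub>1 (l t) + cnj c *\<^sub>M P\<^sub>2 (l t))) (at t)"
    unfolding J_def has_vector_derivative_diff_const
    by (intro bounded_linear.has_vector_derivative
          [OF bounded_bilinear.bounded_linear_right [OF bounded_bilinear_mscale]] vderiv_P l)
qed

text \<open>\<open>P\<^sub>1 P = 0\<close> and \<open>P\<^sub>2 P = P\<^sub>2\<close>, so the
  inverse acts from the right on \<open>P\<^sub>1\<close> as \<open>- 1 / lam\<close> and on
  \<open>P\<^sub>2\<close> as \<open>- 1 / cnj lam\<close>.\<close>

lemma log_deriv_J:
  "((lam - cnj lam) *\<^sub>M (a *\<^sub>M P\<^sub>1 s + b *\<^sub>M P\<^sub>2 s)) ** matrix_inv (J s)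
    = (- (lam - cnj lam)) *\<^sub>M ((a / lam) *\<^sub>M P\<^sub>1 s + (b / cnj lam) *\<^sub>M P\<^sub>2 s)"
  unfolding matrix_inv_J mat_eq_mscale [of "1 / lam"] using lam
  by (simp add: matrix_mult_linear mult_table mscale_linear)
    (simp add: vec_eq_iff field_simps)

end

end

subsection \<open>The SU(3) solution\<close>

text \<open>Half of \<open>log_phase w\<close> is the imaginary part of \<open>Ln w\<close> times
  the imaginary unit. Both equations remain true at \<open>w = 0\<close>, so the case
  \<open>\<epsilon>\<^sub>2 = 0\<close> can share the later computation.\<close>

lemma cmod_exp_half_log_phase:
  shows "complex_of_real (cmod w) * exp (1/2 * log_phase w) = w"
    and "complex_of_real (cmod w) * exp (- (1/2 * log_phase w)) = cnj w"
proof -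
  show *: "complex_of_real (cmod w) * exp (1/2 * log_phase w) = w"
  proof (cases "w = 0")
    case False
    have "1/2 * log_phase w = Ln w - complex_of_real (ln (cmod w))"
      using False by (simp add: log_phase_def complex_eq_iff)
    moreover have "exp (complex_of_real (ln (cmod w))) = complex_of_real (cmod w)"
      using False by (metis exp_of_real exp_ln zero_less_norm_iff)
    ultimately have "exp (1/2 * log_phase w) = w / complex_of_real (cmod w)"
      by (simp only: exp_diff exp_Ln [OF False])
    then show ?thesis
      by (metis False mult.commute nonzero_eq_divide_eq norm_eq_zero of_real_eq_0_iff)
  qed simp
  have "cnj (1/2 * log_phase w) = - (1/2 * log_phase w)"
    by (simp add: log_phase_def field_simps)
  with * show "complex_of_real (cmod w) * exp (- (1/2 * log_phase w)) = cnj w"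
    by (metis complex_cnj_complex_of_real complex_cnj_mult exp_cnj)
qed

lemma sqrt_mult_exp_half_ln:
  fixes a b :: real
  assumes "a > 0" "b > 0"
  shows "sqrt (a * b) * exp (1/2 * ln (a / b)) = a" "sqrt (a * b) * exp (- (1/2 * ln (a / b))) = b"
proof -
  have 1: "exp (1/2 * ln (a / b)) = sqrt (a / b)"
    using assms exp_ln [of "sqrt (a / b)"] by (simp add: ln_sqrt)
  show "sqrt (a * b) * exp (1/2 * ln (a / b)) = a"
    using assms by (simp only: 1 real_sqrt_mult real_sqrt_divide) simp
  show "sqrt (a * b) * exp (- (1/2 * ln (a / b))) = b"
    using assms by (simp only: exp_minus 1 real_sqrt_mult real_sqrt_divide) simp
qed

theorem mainTheorem4:
  fixes a\<^sub>1 a\<^sub>2 b\<^sub>1 b\<^sub>2 c\<^sub>1 c\<^sub>2 \<alpha> \<beta> lam :: complex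
    and \<epsilon>01 \<epsilon>02 \<epsilon>03 \<epsilon>\<^sub>2 :: complex
    and E \<epsilon>\<^sub>1 \<epsilon>t\<^sub>1 :: real
    and L A B C X\<^sub>1 X\<^sub>2 X :: "real^4 \<Rightarrow> complex"
    and \<Delta> :: "real^4 \<Rightarrow> real"
    and \<psi> J :: "real^4 \<Rightarrow> complex^3^3"
    and \<Lambda> :: "complex^3^3"
    and \<A> :: "3 gauge_potential"
  assumes lam: "lam \<noteq> 0"
    and eps01: "\<epsilon>01 = a\<^sub>1 * b\<^sub>2 - a\<^sub>2 * b\<^sub>1"
    and eps02: "\<epsilon>02 = b\<^sub>1 * c\<^sub>2 - b\<^sub>2 * c\<^sub>1"
    and eps03: "\<epsilon>03 = c\<^sub>1 * a\<^sub>2 - c\<^sub>2 * a\<^sub>1"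
    and not_all_zero: "\<not> (\<epsilon>01 = 0 \<and> \<epsilon>02 = 0 \<and> \<epsilon>03 = 0)"
    and L: "\<And>x. L x = 1 / complex_of_real (sqrt 2) *
              ((lam * \<alpha> + \<beta>) * complex_of_real (x$1) + (lam * \<beta> - \<alpha>) * complex_of_real (x$2)
             + (lam * \<alpha> - \<beta>) * complex_of_real (x$3) + (lam * \<beta> + \<alpha>) * complex_of_real (x$4))"
    and A: "\<And>x. A x = a\<^sub>1 * exp (L x) + a\<^sub>2 * exp (- L x)"
    and B: "\<And>x. B x = b\<^sub>1 * exp (L x) + b\<^sub>2 * exp (- L x)"
    and C: "\<And>x. C x = c\<^sub>1 * exp (L x) + c\<^sub>2 * exp (- L x)"
    and Delta: "\<And>x. \<Delta> x = (cmod (A x))\<^sup>2 + (cmod (B x))\<^sup>2 + (cmod (C x))\<^sup>2"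
    and psi: "\<And>x. \<psi> x = vector
       [vector [A x,     cnj (B x),   0],
        vector [- B x,   cnj (A x),   C x],
        vector [0,       - cnj (C x), A x]]"
    and Lambda: "\<Lambda> = vector
       [vector [lam, 0,     0],
        vector [0, cnj lam, 0],
        vector [0, 0,     lam]]"
    and J: "\<And>x. J x = (- 1 / \<Delta> x) *\<^sub>R vector
       [vector [lam * ((cmod (A x))\<^sup>2 + (cmod (C x))\<^sup>2) + cnj lam * (cmod (B x))\<^sup>2,
                - (lam - cnj lam) * A x * cnj (B x),
                (lam - cnj lam) * cnj (B x) * C x],
        vector [- (lam - cnj lam) * cnj (A x) * B x,
                lam * ((cmod (B x))\<^sup>2 + (cmod (C x))\<^sup>2) + cnj lam * (cmod (A x))\<^sup>2,
                (lam - cnj lam) * cnj (A x) * C x],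
        vector [(lam - cnj lam) * B x * cnj (C x),
                (lam - cnj lam) * A x * cnj (C x),
                lam * ((cmod (A x))\<^sup>2 + (cmod (B x))\<^sup>2) + cnj lam * (cmod (C x))\<^sup>2]]"
    and A1: "\<And>x. \<A> 1 x = - (1/2) *\<^sub>R (partial_deriv 1 J x ** matrix_inv (J x)
                                    + partial_deriv 3 J x ** matrix_inv (J x))"
    and A3: "\<A> 3 = \<A> 1"
    and A2: "\<And>x. \<A> 2 x = - (1/2) *\<^sub>R (partial_deriv 2 J x ** matrix_inv (J x)
                                    + partial_deriv 4 J x ** matrix_inv (J x))"
    and A4: "\<A> 4 = \<A> 2"
    and E: "E = (cmod \<epsilon>01)\<^sup>2 + (cmod \<epsilon>02)\<^sup>2 + (cmod \<epsilon>03)\<^sup>2"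
    and eps1: "\<epsilon>\<^sub>1 = (cmod a\<^sub>1)\<^sup>2 + (cmod b\<^sub>1)\<^sup>2 + (cmod c\<^sub>1)\<^sup>2"
    and epst1: "\<epsilon>t\<^sub>1 = (cmod a\<^sub>2)\<^sup>2 + (cmod b\<^sub>2)\<^sup>2 + (cmod c\<^sub>2)\<^sup>2"
    and eps2: "\<epsilon>\<^sub>2 = a\<^sub>1 * cnj a\<^sub>2 + b\<^sub>1 * cnj b\<^sub>2 + c\<^sub>1 * cnj c\<^sub>2"
    and X1: "\<And>x. X\<^sub>1 x = cnj (L x) + L x + complex_of_real (1/2 * ln (\<epsilon>\<^sub>1 / \<epsilon>t\<^sub>1))"
    and X2: "\<And>x. X\<^sub>2 x = L x - cnj (L x) + 1/2 * log_phase \<epsilon>\<^sub>2"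
    and X: "\<And>x. X x = L x + cnj (L x) + complex_of_real
              (1/2 * ln (((cmod a\<^sub>1)\<^sup>2 + (cmod b\<^sub>1)\<^sup>2 + (cmod c\<^sub>1)\<^sup>2)
                       / ((cmod a\<^sub>2)\<^sup>2 + (cmod b\<^sub>2)\<^sup>2 + (cmod c\<^sub>2)\<^sup>2)))"
  shows "(\<forall>x. A x \<noteq> 0 \<longrightarrow> invertible (\<psi> x) \<and> J x = - (\<psi> x ** \<Lambda> ** matrix_inv (\<psi> x)))
    \<and> (\<forall>x. det (J x) = - (complex_of_real ((cmod lam)\<^sup>2) * lam))
    \<and> (\<forall>x. dagger (J x) ** J x = mat (complex_of_real ((cmod lam)\<^sup>2))
         \<and> J x ** dagger (J x) = mat (complex_of_real ((cmod lam)\<^sup>2)))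
    \<and> anti_self_dual_YM \<A>
    \<and> (\<forall>\<mu> x. dagger (\<A> \<mu> x) = - \<A> \<mu> x \<and> trace (\<A> \<mu> x) = 0)
    \<and> \<epsilon>\<^sub>1 * \<epsilon>t\<^sub>1 - (cmod \<epsilon>\<^sub>2)\<^sup>2 = E
    \<and> (\<epsilon>\<^sub>2 \<noteq> 0 \<longrightarrow> (\<forall>x. tr_F_F \<A> x =
         8 * ((\<alpha> * cnj \<beta> - cnj \<alpha> * \<beta>) * (lam - cnj lam))\<^sup>2 * complex_of_real E *
         ((2 * complex_of_real (\<epsilon>\<^sub>1 * \<epsilon>t\<^sub>1) * (sinh (X\<^sub>1 x))\<^sup>2
             - 2 * complex_of_real ((cmod \<epsilon>\<^sub>2)\<^sup>2) * (sinh (X\<^sub>2 x))\<^sup>2 - complex_of_real E)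
          / (complex_of_real (sqrt (\<epsilon>\<^sub>1 * \<epsilon>t\<^sub>1)) * cosh (X\<^sub>1 x)
             + complex_of_real (cmod \<epsilon>\<^sub>2) * cosh (X\<^sub>2 x)) ^ 4)))
    \<and> (\<epsilon>\<^sub>2 = 0 \<longrightarrow> (\<forall>x. tr_F_F \<A> x =
         8 * ((\<alpha> * cnj \<beta> - cnj \<alpha> * \<beta>) * (lam - cnj lam))\<^sup>2 * complex_of_real E *
         ((2 * complex_of_real (\<epsilon>\<^sub>1 * \<epsilon>t\<^sub>1) * (sinh (X\<^sub>1 x))\<^sup>2 - complex_of_real E)
          / (complex_of_real (sqrt (\<epsilon>\<^sub>1 * \<epsilon>t\<^sub>1)) * cosh (X\<^sub>1 x)) ^ 4)
       \<and> tr_F_F \<A> x =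
         8 * ((\<alpha> * cnj \<beta> - cnj \<alpha> * \<beta>) * (lam - cnj lam))\<^sup>2 *
         (2 * (1 / cosh (X x))\<^sup>2 - 3 * (1 / cosh (X x)) ^ 4)))"
proof -
  \<comment> \<open>Chosen so that \<open>U\<close> at the phase \<open>L x\<close> is the second
    column of \<open>\<psi> x\<close>.\<close>
  define p q :: "complex^3" where "p = vector [cnj b\<^sub>1, cnj a\<^sub>1, - cnj c\<^sub>1]"
    and "q = vector [cnj b\<^sub>2, cnj a\<^sub>2, - cnj c\<^sub>2]"
  note pq = p_def q_def
  have "exp (cnj s) *s p + exp (- cnj s) *s q \<noteq> 0" for s
  proof
    \<comment> \<open>If \<open>U\<close> vanished, \<open>p\<close> would be a multiple of
      \<open>q\<close>. The factor is named through its conjugate so that the coefficients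
      themselves satisfy \<open>a\<^sub>1 = g * a\<^sub>2\<close> and so on, which kills all three
      minors.\<close>
    define g where "g = - cnj (exp (- cnj s) / exp (cnj s))"
    assume *: "exp (cnj s) *s p + exp (- cnj s) *s q = 0"
    have "p = cnj g *s q"
    proof (rule vec_eq_iff [THEN iffD2], rule allI)
      fix i
      from * have "exp (cnj s) * p $ i + exp (- cnj s) * q $ i = 0"
        by (metis vector_add_component vector_smult_component zero_index)
      then have "p $ i * exp (cnj s) = - (exp (- cnj s) * q $ i)"
        by (simp add: eq_neg_iff_add_eq_0 mult.commute)
      then have "p $ i = - (exp (- cnj s) * q $ i) / exp (cnj s)"
        by (rule nonzero_eq_divide_eq [THEN iffD2, rotated]) simp
      then show "p $ i = (cnj g *s q) $ i"
        by (simp add: g_def)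
    qed
    then have "cnj a\<^sub>1 = cnj (g * a\<^sub>2)" "cnj b\<^sub>1 = cnj (g * b\<^sub>2)" "cnj c\<^sub>1 = cnj (g * c\<^sub>2)"
      by (simp_all add: pq vec_eq_iff forall_3)
    then have "a\<^sub>1 = g * a\<^sub>2" "b\<^sub>1 = g * b\<^sub>2" "c\<^sub>1 = g * c\<^sub>2"
      by (simp_all only: complex_cnj_cancel_iff)
    with not_all_zero show False
      by (simp add: eps01 eps02 eps03)
  qed
  then interpret sol: exp_line p q
    by unfold_locales

  \<comment> \<open>\<open>k \<mu>\<close> is the derivative of \<open>L\<close>, and \<open>\<gamma> \<mu>\<close> the coefficient of \<open>P\<^sub>1\<close> in the potential.\<close>
  define r where "r = 1 / complex_of_real (sqrt 2)"
  have r2: "r * r = 1/2"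
    by (simp add: r_def flip: of_real_mult)
  define k :: "4 \<Rightarrow> complex" where "k \<mu> = (if \<mu> = 1 then lam * \<alpha> + \<beta> else if \<mu> = 2 then lam * \<beta> - \<alpha>
    else if \<mu> = 3 then lam * \<alpha> - \<beta> else lam * \<beta> + \<alpha>) * r" for \<mu>
  define \<gamma> :: "4 \<Rightarrow> complex" where "\<gamma> \<mu> = (if \<mu> = 1 \<or> \<mu> = 3 then \<alpha> else \<beta>) * r" for \<mu>
  have k: "k 1 = (lam * \<alpha> + \<beta>) * r" "k 2 = (lam * \<beta> - \<alpha>) * r"
      "k 3 = (lam * \<alpha> - \<beta>) * r" "k 4 = (lam * \<beta> + \<alpha>) * r"
    and \<gamma>: "\<gamma> 1 = \<alpha> * r" "\<gamma> 2 = \<beta> * r" "\<gamma> 3 = \<alpha> * r" "\<gamma> 4 = \<beta> * r"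
    by (simp_all add: k_def \<gamma>_def)
  have cnj_r: "cnj r = r"
    by (simp add: r_def)
  have L': "L x = (\<Sum>\<mu>\<in>UNIV. k \<mu> * complex_of_real (x $ \<mu>))" for x
    unfolding L sum_4 k r_def [symmetric] by algebra

  \<comment> \<open>\<open>J\<close> and the gauge potential in terms of the projector\<close>
  have U: "sol.U (L x) = vector [cnj (B x), cnj (A x), - cnj (C x)]" for x
    unfolding sol.U_def by (simp add: pq vec_eq_iff forall_3 A B C cnj_exp algebra_simps)
  have \<Delta>': "sol.\<Delta> (L x) = complex_of_real (\<Delta> x)" for x
    unfolding sol.\<Delta>_def hprod_def U Delta of_real_add complex_norm_square
    by (simp add: sum_3 algebra_simps)
  have \<Delta>_nz: "complex_of_real (\<Delta> x) \<noteq> 0" for x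
    using sol.\<Delta>_nz [of "L x"] by (simp add: \<Delta>')
  have J': "J x = sol.J lam (L x)" for x
  proof -
    have D: "complex_of_real (\<Delta> x) = A x * cnj (A x) + B x * cnj (B x) + C x * cnj (C x)"
      unfolding Delta of_real_add complex_norm_square ..
    have neg: "(- 1 / d) *\<^sub>R M = (1 / complex_of_real d) *\<^sub>M N" if "M = - N"
      for d and M N :: "complex^3^3"
      unfolding that scaleR_eq_mscale by (simp add: vec_eq_iff)
    have "J x = (1 / complex_of_real (\<Delta> x)) *\<^sub>M
        ((lam - cnj lam) *\<^sub>M outer (sol.U (L x)) (sol.U (L x)) - mat (complex_of_real (\<Delta> x) * lam))"
      unfolding J of_real_add complex_norm_square U
      by (rule neg) (simp add: vec_eq_iff forall_3 mat_def D algebra_simps)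
    also have "mat (complex_of_real (\<Delta> x) * lam) = complex_of_real (\<Delta> x) *\<^sub>M (mat lam :: complex^3^3)"
      by (simp add: vec_eq_iff mat_def)
    finally show ?thesis
      using \<Delta>_nz [of x] unfolding sol.J_def [OF lam] sol.P_def \<Delta>'
      by (simp add: mscale_linear diff_divide_distrib)
  qed

  define \<kappa> where "\<kappa> = lam - cnj lam"
  have dJ: "partial_deriv \<mu> J x ** matrix_inv (J x)
      = (- \<kappa>) *\<^sub>M ((k \<mu> / lam) *\<^sub>M sol.P\<^sub>1 (L x) + (cnj (k \<mu>) / cnj lam) *\<^sub>M sol.P\<^sub>2 (L x))" for \<mu> x
  proof -
    have "J = (\<lambda>x. sol.J lam (L x))"
      by (simp add: J' fun_eq_iff)
    then show ?thesis
      using sol.partial_deriv_J [OF lam, of L k \<mu> x] L' sol.log_deriv_J [OF lam] by (simp add: \<kappa>_def)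
  qed
  \<comment> \<open>The sums correspond to the z and w directions, where the derivative of
    \<open>L\<close> carries a factor \<open>lam\<close>. It cancels the denominators in
    \<open>dJ\<close> and leaves the coefficients \<open>\<gamma>\<close>.\<close>
  have k13: "k 1 + k 3 = 2 * lam * (\<alpha> * r)" and k24: "k 2 + k 4 = 2 * lam * (\<beta> * r)"
    by (simp_all add: k algebra_simps)
  have half: "- (1/2) *\<^sub>R (partial_deriv \<mu> J x ** matrix_inv (J x) + partial_deriv \<nu> J x ** matrix_inv (J x))
      = \<kappa> *\<^sub>M (g *\<^sub>M sol.P\<^sub>1 (L x) + cnj g *\<^sub>M sol.P\<^sub>2 (L x))"
    if "k \<mu> + k \<nu> = 2 * lam * g" for \<mu> \<nu> g x
  proof -
    have k\<mu>: "k \<mu> = 2 * lam * g - k \<nu>"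
      using that by (simp add: algebra_simps)
    show ?thesis
      unfolding dJ scaleR_eq_mscale k\<mu> using lam
      by (simp add: vec_eq_iff field_simps)
  qed
  have \<A>: "\<A> \<mu> x = \<kappa> *\<^sub>M (\<gamma> \<mu> *\<^sub>M sol.P\<^sub>1 (L x) + cnj (\<gamma> \<mu>) *\<^sub>M sol.P\<^sub>2 (L x))" for \<mu> x
  proof -
    have "\<A> 1 x = \<kappa> *\<^sub>M (\<gamma> 1 *\<^sub>M sol.P\<^sub>1 (L x) + cnj (\<gamma> 1) *\<^sub>M sol.P\<^sub>2 (L x))"
      unfolding A1 \<gamma> by (rule half [OF k13])
    moreover have "\<A> 2 x = \<kappa> *\<^sub>M (\<gamma> 2 *\<^sub>M sol.P\<^sub>1 (L x) + cnj (\<gamma> 2) *\<^sub>M sol.P\<^sub>2 (L x))"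
      unfolding A2 \<gamma> by (rule half [OF k24])
    ultimately show ?thesis
      using exhaust_4 [of \<mu>] by (auto simp: A3 A4 \<gamma>)
  qed

  \<comment> \<open>Diagonalization by \<open>\<psi>\<close> and the determinant of
    \<open>J\<close>\<close>
  have psi_J: "invertible (\<psi> x) \<and> J x = - (\<psi> x ** \<Lambda> ** matrix_inv (\<psi> x))" if "A x \<noteq> 0" for x
  proof -
    have D: "complex_of_real (\<Delta> x) = A x * cnj (A x) + B x * cnj (B x) + C x * cnj (C x)"
      unfolding Delta of_real_add complex_norm_square ..
    have "det (\<psi> x) = A x * complex_of_real (\<Delta> x)"
      unfolding D by (simp add: det_3 psi algebra_simps)
    then have inv: "invertible (\<psi> x)"
      using that \<Delta>_nz [of x] by (simp add: invertible_det_nz)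
    \<comment> \<open>The first and third columns of \<open>\<psi>\<close> are orthogonal to the
      second, which is \<open>U\<close>; so the projector keeps the second column and annihilates
      the others.\<close>
    have "outer (sol.U (L x)) (sol.U (L x)) ** \<psi> x
        = complex_of_real (\<Delta> x) *\<^sub>M (\<psi> x ** (vector [vector [0,0,0], vector [0,1,0], vector [0,0,0]]))"
      unfolding U D by (simp add: vec_eq_iff forall_3 matrix_matrix_mult_def sum_3 psi algebra_simps)
    then have "sol.P (L x) ** \<psi> x
        = \<psi> x ** (vector [vector [0,0,0], vector [0,1,0], vector [0,0,0]])"
      using \<Delta>_nz [of x] by (simp add: sol.P_def \<Delta>')
    then have "J x ** \<psi> x = - (\<psi> x ** \<Lambda>)"
      by (simp add: J' sol.J_def [OF lam] matrix_mult_linear mat_mult)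
        (simp add: vec_eq_iff forall_3 matrix_matrix_mult_def sum_3 Lambda algebra_simps)
    moreover have "\<psi> x ** matrix_inv (\<psi> x) = mat 1"
      using inv unfolding invertible_def matrix_inv_def by (metis (mono_tags, lifting) someI_ex)
    ultimately have "J x = - (\<psi> x ** \<Lambda>) ** matrix_inv (\<psi> x)"
      by (metis matrix_mul_assoc matrix_mul_rid)
    also have "\<dots> = - (\<psi> x ** \<Lambda> ** matrix_inv (\<psi> x))"
      by (simp add: vec_eq_iff matrix_matrix_mult_def sum_negf)
    finally show ?thesis
      using inv by simp
  qed

  have det_J: "det (J x) = - (complex_of_real ((cmod lam)\<^sup>2) * lam)" for x
  proof -
    define t where "t = \<kappa> / complex_of_real (\<Delta> x)"
    have t: "t * (A x * cnj (A x) + B x * cnj (B x) + C x * cnj (C x)) = \<kappa>"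
      using \<Delta>_nz [of x] unfolding t_def Delta of_real_add complex_norm_square by simp
    have J_t: "J x = t *\<^sub>M outer (sol.U (L x)) (sol.U (L x)) - mat lam"
      by (simp add: J' sol.J_def [OF lam] sol.P_def \<Delta>' t_def \<kappa>_def)
    \<comment> \<open>The determinant of a rank-one perturbation of \<open>- lam\<close>: in
      dimension 3 it is affine in \<open>t\<close> times the squared norm of
      \<open>U\<close>.\<close>
    have "det (J x)
        = lam\<^sup>2 * (t * (A x * cnj (A x) + B x * cnj (B x) + C x * cnj (C x))) - lam ^ 3"
      unfolding J_t U det_3
      by (simp add: mat_def power2_eq_square power3_eq_cube algebra_simps)
    then show ?thesis
      unfolding t complex_norm_square
      by (simp add: \<kappa>_def power2_eq_square power3_eq_cube algebra_simps)
  qed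

  \<comment> \<open>Anti-self-duality and the gauge group\<close>
  have "(\<Sum>\<mu>\<in>UNIV. complex_of_real (e_z $ \<mu>) * g \<mu>) = r * (g 1 + g 3)"
      "(\<Sum>\<mu>\<in>UNIV. complex_of_real (e_zt $ \<mu>) * g \<mu>) = r * (g 1 - g 3)"
      "(\<Sum>\<mu>\<in>UNIV. complex_of_real (e_w $ \<mu>) * g \<mu>) = r * (g 2 + g 4)"
      "(\<Sum>\<mu>\<in>UNIV. complex_of_real (e_wt $ \<mu>) * g \<mu>) = r * (g 4 - g 2)" for g
    by (simp_all add: sum_4 e_z_def e_zt_def e_w_def e_wt_def axis_def r_def
        add_divide_distrib diff_divide_distrib)
  note d = this
  have rzr: "r * (z * r) = z / 2" for z
    using r2 by algebra
  have d\<gamma>: "(\<Sum>\<mu>\<in>UNIV. complex_of_real (e_z $ \<mu>) * \<gamma> \<mu>) = \<alpha>"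
      "(\<Sum>\<mu>\<in>UNIV. complex_of_real (e_zt $ \<mu>) * \<gamma> \<mu>) = 0"
      "(\<Sum>\<mu>\<in>UNIV. complex_of_real (e_w $ \<mu>) * \<gamma> \<mu>) = \<beta>"
      "(\<Sum>\<mu>\<in>UNIV. complex_of_real (e_wt $ \<mu>) * \<gamma> \<mu>) = 0"
    and dk: "(\<Sum>\<mu>\<in>UNIV. complex_of_real (e_z $ \<mu>) * k \<mu>) = lam * \<alpha>"
      "(\<Sum>\<mu>\<in>UNIV. complex_of_real (e_zt $ \<mu>) * k \<mu>) = \<beta>"
      "(\<Sum>\<mu>\<in>UNIV. complex_of_real (e_w $ \<mu>) * k \<mu>) = lam * \<beta>"
      "(\<Sum>\<mu>\<in>UNIV. complex_of_real (e_wt $ \<mu>) * k \<mu>) = \<alpha>"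
    unfolding d \<gamma> k left_diff_distrib [symmetric] distrib_right [symmetric] rzr
    by simp_all
  \<comment> \<open>In the zw component the mixed terms cancel against the commutator because
    \<open>\<kappa> = lam - cnj lam\<close>. In the second equation both potentials vanish, and in
    the third the two components coincide.\<close>
  have asd: "anti_self_dual_YM \<A>"
    unfolding anti_self_dual_YM_def sol.field_strength_along_potential [OF L' \<A>]
      d\<gamma> dk by (simp add: curv_hol_def curv_mixed_def \<kappa>_def algebra_simps)

  \<comment> \<open>The combination of \<open>P\<^sub>1\<close> and \<open>P\<^sub>2\<close> is
    Hermitian and traceless, and \<open>\<kappa>\<close> is purely imaginary.\<close>
  have skew: "dagger (\<A> \<mu> x) = - \<A> \<mu> x \<and> trace (\<A> \<mu> x) = 0" for \<mu> x
    unfolding \<A> by (simp add: dagger_simps sol.daggers trace_linear sol.traces)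
      (simp add: \<kappa>_def vec_eq_iff algebra_simps)

  \<comment> \<open>The Gram matrix of \<open>p\<close> and \<open>q\<close>\<close>
  have pp: "hprod p p = complex_of_real \<epsilon>\<^sub>1" and qq: "hprod q q = complex_of_real \<epsilon>t\<^sub>1"
    and p_q: "hprod p q = \<epsilon>\<^sub>2" and q_p: "hprod q p = cnj \<epsilon>\<^sub>2"
    unfolding eps1 epst1 eps2 of_real_add complex_norm_square
    by (simp_all add: hprod_def pq sum_3)
  \<comment> \<open>Lagrange's identity: the Gram determinant is the sum of the squared moduli of
    the 2x2 minors.\<close>
  have gram: "complex_of_real (\<epsilon>\<^sub>1 * \<epsilon>t\<^sub>1 - (cmod \<epsilon>\<^sub>2)\<^sup>2) = complex_of_real E"
    unfolding E eps1 epst1 of_real_diff of_real_mult of_real_add complex_norm_square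
      eps2 eps01 eps02 eps03
    by (simp add: algebra_simps)
  then have gram': "\<epsilon>\<^sub>1 * \<epsilon>t\<^sub>1 - (cmod \<epsilon>\<^sub>2)\<^sup>2 = E"
    by (simp only: of_real_eq_iff)
  have "\<epsilon>\<^sub>1 \<ge> 0" "\<epsilon>t\<^sub>1 \<ge> 0" "E > 0"
    using not_all_zero by (auto simp: eps1 epst1 E add_nonneg_pos add_pos_nonneg)
  then have pos: "\<epsilon>\<^sub>1 > 0" "\<epsilon>t\<^sub>1 > 0"
    using gram' by (smt (verit) mult_eq_0_iff zero_le_power2)+

  \<comment> \<open>Contraction of the field strength with the split metric\<close>
  define D where "D = \<alpha> * cnj \<beta> - cnj \<alpha> * \<beta>"
  have 1: "curv_hol (a * r) (b * r) (c * r) (d * r) = curv_hol a b c d / 2" for a b c d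
    unfolding curv_hol_def using r2 by algebra
  have 2: "curv_mixed \<kappa> (a * r) (b * r) (c * r) (d * r) = curv_mixed \<kappa> a b c d / 2" for a b c d
    unfolding curv_mixed_def complex_cnj_mult cnj_r using r2 by algebra
  have tr: "tr_F_F \<A> x = 4 * (D * \<kappa>)\<^sup>2 *
      (4 * (sol.h (L x) * cnj (sol.h (L x))) * sol.G (L x) - 2 * (sol.G (L x))\<^sup>2)" for x
  proof -
    define \<eta> where "\<eta> \<mu> = complex_of_real (split_metric $ \<mu> $ \<mu>)" for \<mu>
    have \<eta>: "\<eta> 1 = 1" "\<eta> 2 = 1" "\<eta> 3 = -1" "\<eta> 4 = -1"
      by (simp_all add: \<eta>_def split_metric_def)
    define f where "f \<mu> \<nu> = curv_hol (\<gamma> \<mu>) (k \<mu>) (\<gamma> \<nu>) (k \<nu>)" for \<mu> \<nu>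
    define g where "g \<mu> \<nu> = curv_mixed \<kappa> (\<gamma> \<mu>) (k \<mu>) (\<gamma> \<nu>) (k \<nu>)" for \<mu> \<nu>
    have f: "f 1 2 = (\<alpha>\<^sup>2 + \<beta>\<^sup>2) / 2" "f 3 4 = - (\<alpha>\<^sup>2 + \<beta>\<^sup>2) / 2" "f 1 3 = \<alpha> * \<beta>"
        "f 2 4 = - \<alpha> * \<beta>" "f 1 4 = (\<beta>\<^sup>2 - \<alpha>\<^sup>2) / 2" "f 2 3 = (\<beta>\<^sup>2 - \<alpha>\<^sup>2) / 2"
      and g: "g 1 2 = \<alpha> * cnj \<alpha> + \<beta> * cnj \<beta>" "g 3 4 = - \<alpha> * cnj \<alpha> - \<beta> * cnj \<beta>"
        "g 1 3 = \<alpha> * cnj \<beta> + cnj \<alpha> * \<beta>" "g 2 4 = - \<alpha> * cnj \<beta> - cnj \<alpha> * \<beta>"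
        "g 1 4 = \<beta> * cnj \<beta> - \<alpha> * cnj \<alpha>" "g 2 3 = \<beta> * cnj \<beta> - \<alpha> * cnj \<alpha>"
      unfolding f_def g_def \<gamma> k 1 2 unfolding curv_hol_def curv_mixed_def \<kappa>_def
      by (simp_all add: field_simps power2_eq_square)
    have skew: "f \<mu> \<mu> = 0" "g \<mu> \<mu> = 0" "f \<mu> \<nu> = - f \<nu> \<mu>" "g \<mu> \<nu> = - g \<nu> \<mu>" for \<mu> \<nu>
      by (simp_all add: f_def g_def curv_hol_def curv_mixed_def algebra_simps)
    \<comment> \<open>Antisymmetry is instantiated only for decreasing index pairs, since the
      general equation would unfold forever.\<close>
    note fg = f g skew(1,2) skew(3,4) [of 2 1] skew(3,4) [of 3 1] skew(3,4) [of 4 1]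
      skew(3,4) [of 3 2] skew(3,4) [of 4 2] skew(3,4) [of 4 3]
    \<comment> \<open>The minus signs of the metric turn both sums into multiples of
      \<open>D\<^sup>2\<close>; the opposite signs here and in \<open>S2\<close> produce the
      difference in the trace.\<close>
    have S1: "(\<Sum>\<mu>\<in>UNIV. \<Sum>\<nu>\<in>UNIV. \<eta> \<mu> * \<eta> \<nu> * (f \<mu> \<nu> * cnj (f \<mu> \<nu>))) = 2 * D\<^sup>2"
      unfolding sum_4 fg \<eta> D_def by (simp add: algebra_simps power2_eq_square)
    have S2: "(\<Sum>\<mu>\<in>UNIV. \<Sum>\<nu>\<in>UNIV. \<eta> \<mu> * \<eta> \<nu> * (g \<mu> \<nu>)\<^sup>2) = - 4 * D\<^sup>2"
      unfolding sum_4 fg \<eta> D_def by (simp add: algebra_simps power2_eq_square)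
    have "tr_F_F \<A> x = 8 * \<kappa>\<^sup>2 * (sol.h (L x) * cnj (sol.h (L x))) * sol.G (L x) * (2 * D\<^sup>2)
        + 2 * \<kappa>\<^sup>2 * (sol.G (L x))\<^sup>2 * (- 4 * D\<^sup>2)"
      unfolding S1 [symmetric] S2 [symmetric] sol.tr_F_F_potential [OF L' \<A>] \<eta>_def
        f_def g_def
        sum_distrib_left sum.distrib [symmetric]
      by (intro sum.cong refl) (simp add: algebra_simps)
    then show ?thesis
      by (simp add: algebra_simps power_mult_distrib)
  qed

  \<comment> \<open>Hyperbolic form of the trace\<close>
  define S where "S = complex_of_real (sqrt (\<epsilon>\<^sub>1 * \<epsilon>t\<^sub>1))"
  define T where "T = complex_of_real (cmod \<epsilon>\<^sub>2)"
  have S2: "S\<^sup>2 = complex_of_real (\<epsilon>\<^sub>1 * \<epsilon>t\<^sub>1)"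
    using pos by (simp add: S_def flip: of_real_power of_real_mult)
  have T2: "T\<^sup>2 = complex_of_real ((cmod \<epsilon>\<^sub>2)\<^sup>2)"
    by (simp add: T_def)
  have SX: "S * exp (X\<^sub>1 x) = exp (cnj (L x)) * exp (L x) * complex_of_real \<epsilon>\<^sub>1"
      "S * exp (- X\<^sub>1 x) = exp (- L x) * exp (- cnj (L x)) * complex_of_real \<epsilon>t\<^sub>1" for x
  proof -
    have 1: "S * exp (complex_of_real (1/2 * ln (\<epsilon>\<^sub>1 / \<epsilon>t\<^sub>1))) = complex_of_real \<epsilon>\<^sub>1"
      "S * exp (- complex_of_real (1/2 * ln (\<epsilon>\<^sub>1 / \<epsilon>t\<^sub>1))) = complex_of_real \<epsilon>t\<^sub>1"
      unfolding S_def exp_of_real of_real_minus [symmetric] of_real_mult [symmetric]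
        sqrt_mult_exp_half_ln [OF pos] by (rule refl)+
    show "S * exp (X\<^sub>1 x) = exp (cnj (L x)) * exp (L x) * complex_of_real \<epsilon>\<^sub>1"
      "S * exp (- X\<^sub>1 x) = exp (- L x) * exp (- cnj (L x)) * complex_of_real \<epsilon>t\<^sub>1"
      unfolding 1 [symmetric] X1 minus_add_distrib exp_add by (simp_all only: mult_ac)
  qed
  \<comment> \<open>In \<open>sol.\<Delta>\<close> the term with
    \<open>hprod p q = \<epsilon>\<^sub>2\<close> carries \<open>exp (L - cnj L)\<close>, which
    matches the sign of the phase in \<open>X\<^sub>2\<close>.\<close>
  have TX: "T * exp (X\<^sub>2 x) = exp (L x) * exp (- cnj (L x)) * \<epsilon>\<^sub>2"
      "T * exp (- X\<^sub>2 x) = exp (cnj (L x)) * exp (- L x) * cnj \<epsilon>\<^sub>2" for x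
  proof -
    have m: "X\<^sub>2 x = L x + - cnj (L x) + 1/2 * log_phase \<epsilon>\<^sub>2"
      "- X\<^sub>2 x = cnj (L x) + - L x + - (1/2 * log_phase \<epsilon>\<^sub>2)"
      by (simp_all add: X2)
    show "T * exp (X\<^sub>2 x) = exp (L x) * exp (- cnj (L x)) * \<epsilon>\<^sub>2"
      by (subst (2) cmod_exp_half_log_phase(1) [symmetric]) (simp only: m exp_add T_def mult_ac)
    show "T * exp (- X\<^sub>2 x) = exp (cnj (L x)) * exp (- L x) * cnj \<epsilon>\<^sub>2"
      unfolding cmod_exp_half_log_phase(2) [of \<epsilon>\<^sub>2, symmetric] T_def m(2) exp_add
      by (simp only: mult_ac)
  qed
  have \<Delta>2: "sol.\<Delta> (L x) = 2 * (S * cosh (X\<^sub>1 x) + T * cosh (X\<^sub>2 x))" for x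
    unfolding sol.\<Delta>_eq pp qq p_q q_p SX [symmetric] TX [symmetric] cosh_field_def
    by (simp add: field_simps)
  have N: "hprod (sol.U (L x)) (sol.V (L x)) = 2 * (S * sinh (X\<^sub>1 x) - T * sinh (X\<^sub>2 x))" for x
    unfolding sol.hprod_UV pp qq p_q q_p SX [symmetric] TX [symmetric] sinh_field_def
    by (simp add: field_simps)
  \<comment> \<open>Conjugation reverses the sign of the \<open>T\<close> term, so the product with
    \<open>N\<close> is a difference of squares: the two sinh terms of the numerator.\<close>
  have N': "cnj (hprod (sol.U (L x)) (sol.V (L x))) = 2 * (S * sinh (X\<^sub>1 x) + T * sinh (X\<^sub>2 x))" for x
  proof -
    have "cnj (hprod (sol.U (L x)) (sol.V (L x)))
        = S * exp (X\<^sub>1 x) - T * exp (- X\<^sub>2 x) + T * exp (X\<^sub>2 x) - S * exp (- X\<^sub>1 x)"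
      unfolding sol.hprod_UV pp qq p_q q_p SX TX by (simp add: cnj_exp)
    also have "\<dots> = 2 * (S * sinh (X\<^sub>1 x) + T * sinh (X\<^sub>2 x))"
      by (simp add: sinh_field_def field_simps)
    finally show ?thesis .
  qed

  have main: "tr_F_F \<A> x = 8 * (D * \<kappa>)\<^sup>2 * complex_of_real E *
         ((2 * complex_of_real (\<epsilon>\<^sub>1 * \<epsilon>t\<^sub>1) * (sinh (X\<^sub>1 x))\<^sup>2
             - 2 * complex_of_real ((cmod \<epsilon>\<^sub>2)\<^sup>2) * (sinh (X\<^sub>2 x))\<^sup>2 - complex_of_real E)
          / (complex_of_real (sqrt (\<epsilon>\<^sub>1 * \<epsilon>t\<^sub>1)) * cosh (X\<^sub>1 x)
             + complex_of_real (cmod \<epsilon>\<^sub>2) * cosh (X\<^sub>2 x)) ^ 4)" for x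
  proof -
    define m where "m = S * cosh (X\<^sub>1 x) + T * cosh (X\<^sub>2 x)"
    have m: "m \<noteq> 0" "sol.\<Delta> (L x) = 2 * m"
      using sol.\<Delta>_nz [of "L x"] unfolding \<Delta>2 m_def [symmetric] by simp_all
    have h: "sol.h (L x) = (S * sinh (X\<^sub>1 x) - T * sinh (X\<^sub>2 x)) / m"
      unfolding sol.h_def N m(2) by (rule mult_divide_mult_cancel_left) simp
    have h': "cnj (sol.h (L x)) = (S * sinh (X\<^sub>1 x) + T * sinh (X\<^sub>2 x)) / m"
      unfolding sol.h_def complex_cnj_divide sol.cnj_\<Delta> N' unfolding m(2)
      by (rule mult_divide_mult_cancel_left) simp
    have "hprod p p * hprod q q - hprod p q * hprod q p = complex_of_real E"
      unfolding gram [symmetric] pp qq p_q q_p of_real_diff of_real_mult complex_norm_square ..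
    then have G: "sol.G (L x) = complex_of_real E / m\<^sup>2"
      by (simp add: sol.G_eq m(2) power_mult_distrib)
    show ?thesis
      unfolding tr h' unfolding h G S_def [symmetric] T_def [symmetric] m_def [symmetric]
        S2 [symmetric] T2 [symmetric]
      using m(1) by (simp add: field_simps power2_eq_square power4_eq_xxxx)
  qed
  \<comment> \<open>Here \<open>E\<close> equals \<open>S\<^sup>2\<close>, so \<open>S\<close>
    cancels entirely, and replacing sinh squared by cosh squared minus 1 turns the numerator into a
    multiple of \<open>2 * (cosh (X x))\<^sup>2 - 3\<close>.\<close>
  have *: "8 * (D * \<kappa>)\<^sup>2 * complex_of_real E *
         ((2 * complex_of_real (\<epsilon>\<^sub>1 * \<epsilon>t\<^sub>1) * (sinh (X\<^sub>1 x))\<^sup>2 - complex_of_real E)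
          / (complex_of_real (sqrt (\<epsilon>\<^sub>1 * \<epsilon>t\<^sub>1)) * cosh (X\<^sub>1 x)) ^ 4)
       = 8 * (D * \<kappa>)\<^sup>2 * (2 * (1 / cosh (X x))\<^sup>2 - 3 * (1 / cosh (X x)) ^ 4)"
    if "\<epsilon>\<^sub>2 = 0" for x
  proof -
    have E': "complex_of_real E = S\<^sup>2" "\<epsilon>\<^sub>1 * \<epsilon>t\<^sub>1 = E"
      using that gram' by (simp_all add: S2)
    have X': "X x = X\<^sub>1 x"
      by (simp add: X X1 eps1 epst1)
    have nz: "S \<noteq> 0" "cosh (X\<^sub>1 x) \<noteq> 0"
      using sol.\<Delta>_nz [of "L x"] that by (auto simp: \<Delta>2 T_def)
    have sinh: "(sinh (X\<^sub>1 x))\<^sup>2 = (cosh (X\<^sub>1 x))\<^sup>2 - 1"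
      by (simp add: cosh_square_eq)
    show ?thesis
      unfolding S_def [symmetric] S2 [symmetric] E'(1) X' sinh using nz
      by (simp add: field_simps power2_eq_square power4_eq_xxxx)
  qed
  show ?thesis
    using psi_J det_J sol.dagger_J [OF lam] sol.J_dagger [OF lam] asd skew gram' main *
    unfolding J' D_def \<kappa>_def
    by simp
qed

end
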